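(* Let $d$ be an integer with $d = 3$ or $d > 8$. Consider the game in which Nora and Wanda choose the coefficients of a degree $d$ polynomial from $\mathbb{Q}$, and Wanda wins if and only if the final polynomial has a root in $D_2$, where $D_2$ is any subring of the maximal abelian extension of $\mathbb{Q}$. Then the player who makes the last move has a winning strategy.
   Context: The game: Nora and Wanda alternately choose coefficients of $f(x) = a_d x^d + \cdots + a_0$; on each move the current player picks a not-yet-chosen coefficient and assigns it a rational value, subject to $a_d \neq 0$, $a_0 \neq 0$. After all $d+1$ coefficients are chosen, Wanda wins if $f$ has a root in $D_2$ and Nora wins otherwise. Who moves first is fixed in advance. The maximal abelian extension of $\mathbb{Q}$ is the union (inside a fixed algebraic closure) of all finite abelian extensions of $\mathbb{Q}$; equivalently, the union of all cyclotomic fields $\mathbb{Q}(\zeta_n)$. *)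

theory Defs
  imports Complex_Main
begin

definition is_subring :: "complex set \<Rightarrow> bool" where
  "is_subring R \<longleftrightarrow> 0 \<in> R \<and> 1 \<in> R \<and>
     (\<forall>x\<in>R. \<forall>y\<in>R. x + y \<in> R \<and> x * y \<in> R) \<and> (\<forall>x\<in>R. - x \<in> R)"

definition is_subfield :: "complex set \<Rightarrow> bool" where
  "is_subfield K \<longleftrightarrow> is_subring K \<and> (\<forall>x\<in>K. x \<noteq> 0 \<longrightarrow> inverse x \<in> K)"

definition zeta :: "nat \<Rightarrow> complex" where
  "zeta n = cis (2 * pi / real n)"

definition cyclotomic_field :: "nat \<Rightarrow> complex set" where
  "cyclotomic_field n = \<Inter> {K. is_subfield K \<and> zeta n \<in> K}"

definition Qab :: "complex set" where
  "Qab = (\<Union>n\<in>{1..}. cyclotomic_field n)"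

text \<open>A position is a partial assignment of rational values to the coefficient
  indices 0..d.  A move assigns a value v to a not yet chosen index i, with
  the leading and constant coefficients required to be nonzero.\<close>

definition legal_move :: "nat \<Rightarrow> (nat \<Rightarrow> rat option) \<Rightarrow> nat \<Rightarrow> rat \<Rightarrow> bool" where
  "legal_move d s i v \<longleftrightarrow> i \<le> d \<and> s i = None \<and> ((i = 0 \<or> i = d) \<longrightarrow> v \<noteq> 0)"

definition has_root_in :: "nat \<Rightarrow> complex set \<Rightarrow> (nat \<Rightarrow> rat option) \<Rightarrow> bool" where
  "has_root_in d D s \<longleftrightarrow> (\<exists>z\<in>D. (\<Sum>i\<le>d. of_rat (the (s i)) * z ^ i) = 0)"

text \<open>W d D t n s: from position s, with n moves remaining and Wanda to move iff t,
  Wanda has a winning strategy.  N: the same for Nora.\<close>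
fun W :: "nat \<Rightarrow> complex set \<Rightarrow> bool \<Rightarrow> nat \<Rightarrow> (nat \<Rightarrow> rat option) \<Rightarrow> bool" where
  "W d D t 0 s = has_root_in d D s"
| "W d D t (Suc n) s =
     (if t then (\<exists>i v. legal_move d s i v \<and> W d D (\<not> t) n (s(i \<mapsto> v)))
      else (\<forall>i v. legal_move d s i v \<longrightarrow> W d D (\<not> t) n (s(i \<mapsto> v))))"

fun N :: "nat \<Rightarrow> complex set \<Rightarrow> bool \<Rightarrow> nat \<Rightarrow> (nat \<Rightarrow> rat option) \<Rightarrow> bool" where
  "N d D t 0 s = (\<not> has_root_in d D s)"
| "N d D t (Suc n) s =
     (if t then (\<forall>i v. legal_move d s i v \<longrightarrow> N d D (\<not> t) n (s(i \<mapsto> v)))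
      else (\<exists>i v. legal_move d s i v \<and> N d D (\<not> t) n (s(i \<mapsto> v))))"

definition wanda_has_winning_strategy :: "nat \<Rightarrow> complex set \<Rightarrow> bool \<Rightarrow> bool" where
  "wanda_has_winning_strategy d D wanda_first = W d D wanda_first (d + 1) Map.empty"

definition nora_has_winning_strategy :: "nat \<Rightarrow> complex set \<Rightarrow> bool \<Rightarrow> bool" where
  "nora_has_winning_strategy d D wanda_first = N d D wanda_first (d + 1) Map.empty"

text \<open>Whether Wanda makes move number k (moves numbered 1, 2, ...).\<close>
definition wanda_makes_move :: "bool \<Rightarrow> nat \<Rightarrow> bool" where
  "wanda_makes_move wanda_first k = (if wanda_first then odd k else even k)"

end

theory Submission
  imports Defs "HOL-Number_Theory.Residues" "HOL-Computational_Algebra.Polynomial_Factorial"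
    "HOL-Computational_Algebra.Field_as_Ring"
begin

text \<open>
  If Wanda moves last, she makes a suitable nonzero integer a root.

  If Nora moves last and the last free index is \<open>i\<close>, she sets \<open>a\<^sub>i = p\<^sup>-\<^sup>k\<close> with \<open>k\<close> huge. The \<open>p\<close>-adic
  Newton polygon of \<open>f\<close> then has only the vertices \<open>0\<close>, \<open>i\<close>, \<open>d\<close>, so a root has valuation
  \<open>(v(a\<^sub>0) + k) / i\<close> or \<open>- (v(a\<^sub>d) + k) / (d - i)\<close>. On the other hand \<open>p\<close> has ramification index
  \<open>p\<^sup>r (p - 1)\<close> in a cyclotomic field, so valuations of elements of the maximal abelian extension have
  denominators dividing some \<open>p\<^sup>r (p - 1)\<close>. A prime \<open>p \<in> {2, 3, 11}\<close> and a \<open>k\<close> violating this exist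
  when \<open>i \<in> {0, d}\<close>, or \<open>i\<close> and \<open>d - i\<close> are both at least \<open>3\<close> and not both \<open>4\<close>. For \<open>d > 8\<close> Nora has at
  least four moves before her last one and spends them on the indices \<open>1, 2, d - 2, d - 1\<close>.

  For \<open>d = 3\<close> and \<open>i \<in> {1, 2}\<close> she makes the cubic irreducible with exactly one real root, which is
  impossible for a cubic with a root in an abelian field.
\<close>

section \<open>Rational polynomials and cyclotomic fields\<close>

text \<open>Denominators 1 and 2 are never excluded: 2 divides \<open>p^r (p - 1)\<close> for odd
  \<open>p\<close>, and for \<open>p = 2\<close> once \<open>r \<ge> 1\<close>. Hence the last free
  index must be an end or at least 3 away from both ends. Two edges of length 4 fail too: only
  \<open>p\<close> congruent to 3 mod 4 obstructs the denominator 4, and then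
  \<open>v(a_0) + k\<close> and \<open>v(a_d) + k\<close> would both have to be odd, which no
  \<open>k\<close> achieves if \<open>v(a_0)\<close> and \<open>v(a_d)\<close> differ in parity.
  This is why the method misses \<open>d = 8\<close>, although the count of moves would allow it.
  For cubics the number of real roots matters: the minimal polynomial of
  \<open>2 cos (2 pi / 7)\<close> has three real roots, all in an abelian field, whereas a single
  real root forces the Galois group \<open>S_3\<close>. No Galois theory is invoked. On roots of
  unity of order \<open>n\<close>, conjugation is \<open>w ^ (n - 1)\<close>, so being real is a
  polynomial relation that passes to all conjugates. The valuation comes from localizing the ring
  generated by a root of unity at a prime ideal containing \<open>p\<close>.\<close>

definition rpoly :: "rat poly \<Rightarrow> complex \<Rightarrow> complex" where
  "rpoly P z = poly (map_poly of_rat P) z"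

lemma rpoly_0 [simp]: "rpoly 0 z = 0"
  by (simp add: rpoly_def)

lemma rpoly_pCons [simp]: "rpoly (pCons a P) z = of_rat a + z * rpoly P z"
  by (simp add: rpoly_def map_poly_pCons)

lemma rpoly_1 [simp]: "rpoly 1 z = 1"
  by (simp add: rpoly_def)

lemma rpoly_add [simp]: "rpoly (P + Q) z = rpoly P z + rpoly Q z"
  by (induction P Q rule: poly_induct2) (auto simp: algebra_simps of_rat_add)

lemma rpoly_smult [simp]: "rpoly (smult a P) z = of_rat a * rpoly P z"
  by (induction P) (auto simp: algebra_simps of_rat_mult)

lemma rpoly_minus [simp]: "rpoly (- P) z = - rpoly P z"
  using rpoly_smult[of "-1" P z] by simp

lemma rpoly_diff [simp]: "rpoly (P - Q) z = rpoly P z - rpoly Q z"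
  using rpoly_add[of P "- Q" z] by simp

lemma rpoly_mult [simp]: "rpoly (P * Q) z = rpoly P z * rpoly Q z"
  by (induction P) (auto simp: algebra_simps)

lemma rpoly_monom [simp]: "rpoly (monom a k) z = of_rat a * z ^ k"
  by (simp add: rpoly_def map_poly_monom poly_monom)

lemma rpoly_pcompose: "rpoly (pcompose P Q) z = rpoly P (rpoly Q z)"
  by (induction P) (auto simp: pcompose_pCons)

lemma cnj_of_rat [simp]: "cnj (of_rat a) = of_rat a"
  by (cases a) (simp add: of_rat_rat)

lemma cnj_rpoly: "cnj (rpoly P z) = rpoly P (cnj z)"
  by (induction P) auto

text \<open>Generator of the ideal of polynomials vanishing at \<open>z\<close>, not normalized to
  be monic. Irreducibility is never stated; \<open>minpoly_bezout\<close> takes its place.\<close>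

definition is_minpoly :: "complex \<Rightarrow> rat poly \<Rightarrow> bool" where
  "is_minpoly z M \<longleftrightarrow> M \<noteq> 0 \<and> (\<forall>P. rpoly P z = 0 \<longleftrightarrow> M dvd P)"

lemma minpoly_exists:
  assumes "rpoly Q z = 0" "Q \<noteq> 0"
  shows "\<exists>M. is_minpoly z M"
proof -
  let ?A = "\<lambda>M. M \<noteq> 0 \<and> rpoly M z = 0"
  obtain M where M: "?A M" "\<And>P. ?A P \<Longrightarrow> degree M \<le> degree P"
    using assms ex_has_least_nat[of ?A Q degree] by blast
  have "M dvd P" if "rpoly P z = 0" for P
  proof (rule ccontr)
    assume "\<not> M dvd P"
    hence nz: "P mod M \<noteq> 0" by (simp add: mod_eq_0_iff_dvd)
    have "rpoly (P mod M) z = rpoly P z - rpoly M z * rpoly (P div M) z"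
      by (simp flip: rpoly_mult rpoly_diff add: minus_mult_div_eq_mod)
    with M that have "rpoly (P mod M) z = 0" by simp
    with M(2) nz have "degree M \<le> degree (P mod M)" by blast
    with degree_mod_less[of M P] M nz show False by auto
  qed
  moreover have "rpoly P z = 0" if "M dvd P" for P
    using that M by (auto elim!: dvdE)
  ultimately show ?thesis using M unfolding is_minpoly_def by blast
qed

text \<open>A zero of the gcd at \<open>z\<close> would be one of \<open>P\<close>. So the cofactor
  of the gcd in \<open>M\<close> vanishes at \<open>z\<close> and is a multiple of \<open>M\<close>,
  which makes the gcd a unit.\<close>

lemma minpoly_bezout:
  assumes "is_minpoly z M" "rpoly P z \<noteq> 0"
  shows "\<exists>U T. U * P + T * M = 1"
proof -
  obtain h where h: "M = gcd P M * h" by (metis dvd_def gcd_dvd2)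
  have "rpoly (gcd P M) z \<noteq> 0"
    using assms(2) by (metis dvdE gcd_dvd1 mult_eq_0_iff rpoly_mult)
  moreover have "rpoly (gcd P M) z * rpoly h z = 0"
    using assms(1) h unfolding is_minpoly_def by (metis dvd_refl rpoly_mult)
  ultimately have "M dvd h" using assms(1) by (auto simp: is_minpoly_def)
  moreover have "h \<noteq> 0" using h assms(1) by (auto simp: is_minpoly_def)
  ultimately have "is_unit (gcd P M)"
    using h by (metis dvd_mult_cancel_right mult_1)
  hence "gcd P M = 1" by simp
  thus ?thesis by (metis bezout_coefficients_fst_snd)
qed

lemma minpoly_degree_pos:
  assumes "is_minpoly z M" shows "degree M > 0"
proof (rule ccontr)
  assume "\<not> degree M > 0"
  hence "M dvd 1" using assms by (auto simp: is_minpoly_def is_unit_iff_degree)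
  hence "rpoly 1 z = 0" using assms unfolding is_minpoly_def by blast
  thus False by simp
qed

definition Qadj :: "complex \<Rightarrow> complex set" where
  "Qadj z = range (\<lambda>P. rpoly P z)"

lemma Qadj_subfield:
  assumes "is_minpoly z M"
  shows "is_subfield (Qadj z)"
proof -
  have 1: "inverse (rpoly P z) \<in> Qadj z" if nz: "rpoly P z \<noteq> 0" for P
  proof -
    obtain U T where UT: "U * P + T * M = 1" using minpoly_bezout[OF assms nz] by blast
    have "rpoly M z = 0" using assms by (auto simp: is_minpoly_def)
    hence "rpoly U z * rpoly P z = 1"
      using arg_cong[OF UT, of "\<lambda>p. rpoly p z"] by simp
    hence "inverse (rpoly P z) = rpoly U z" using nz by (simp add: field_simps)
    thus ?thesis by (simp add: Qadj_def)
  qed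
  have 2: "0 \<in> Qadj z" "1 \<in> Qadj z"
    unfolding Qadj_def by (metis rangeI rpoly_0, metis rangeI rpoly_1)
  have 3: "x + y \<in> Qadj z" "x * y \<in> Qadj z" "- x \<in> Qadj z"
    if "x \<in> Qadj z" "y \<in> Qadj z" for x y
    using that unfolding Qadj_def
    by (auto simp flip: rpoly_add rpoly_mult rpoly_minus)
  show ?thesis unfolding is_subfield_def is_subring_def
    using 1 2 3 by (auto simp: Qadj_def)
qed

section \<open>Roots of unity and cyclotomic fields\<close>

lemma zeta_power: "n > 0 \<Longrightarrow> zeta n ^ n = 1"
  by (simp add: zeta_def DeMoivre)

lemma rpoly_unity: "rpoly (monom 1 n - 1) z = z ^ n - 1"
  by simp

lemma unity_poly_nonzero: "n > 0 \<Longrightarrow> monom 1 n - (1 :: rat poly) \<noteq> 0"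
  by (metis degree_1 degree_monom_eq eq_iff_diff_eq_0 less_numeral_extra(3) zero_neq_one)

lemma zeta_minpoly:
  assumes "n > 0" obtains M where "is_minpoly (zeta n) M" "M dvd monom 1 n - 1"
proof -
  have 0: "rpoly (monom 1 n - 1) (zeta n) = 0"
    using zeta_power[OF assms] by simp
  then obtain M where "is_minpoly (zeta n) M"
    using minpoly_exists unity_poly_nonzero assms by blast
  with 0 that show ?thesis unfolding is_minpoly_def by blast
qed

lemma gen_in_Qadj: "z \<in> Qadj z"
proof -
  have "rpoly [:0, 1:] z = z" by simp
  thus ?thesis unfolding Qadj_def by (metis rangeI)
qed

lemma cyclotomic_field_subset_Qadj:
  assumes "n > 0" shows "cyclotomic_field n \<subseteq> Qadj (zeta n)"
proof -
  obtain M where "is_minpoly (zeta n) M" using zeta_minpoly assms by blast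
  thus ?thesis
    unfolding cyclotomic_field_def using Qadj_subfield gen_in_Qadj by blast
qed

lemma zeta_mult_power: "n > 0 \<Longrightarrow> k > 0 \<Longrightarrow> zeta (n * k) ^ k = zeta n"
  by (simp add: zeta_def DeMoivre)

text \<open>Allows \<open>n\<close> to be enlarged to a multiple of a given prime.\<close>

lemma cyclotomic_field_mono:
  assumes "n > 0" "k > 0"
  shows "cyclotomic_field n \<subseteq> cyclotomic_field (n * k)"
proof -
  have "zeta n \<in> K" if "is_subfield K" "zeta (n * k) \<in> K" for K
  proof -
    have "zeta (n * k) ^ j \<in> K" for j
      by (induction j) (use that in \<open>auto simp: is_subfield_def is_subring_def\<close>)
    thus ?thesis using zeta_mult_power[OF assms] by metis
  qed
  thus ?thesis unfolding cyclotomic_field_def by blast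
qed

lemma Qab_inverse: "x \<in> Qab \<Longrightarrow> inverse x \<in> Qab"
proof -
  assume "x \<in> Qab"
  then obtain n where n: "n \<ge> 1" "x \<in> cyclotomic_field n" by (auto simp: Qab_def)
  have "inverse x \<in> cyclotomic_field n"
  proof (cases "x = 0")
    case False
    thus ?thesis using n unfolding cyclotomic_field_def is_subfield_def by blast
  qed (use n in auto)
  thus ?thesis using n by (auto simp: Qab_def)
qed

section \<open>Real elements of cyclotomic fields\<close>

text \<open>Separability by counting: \<open>X^n - 1 = M h\<close> has \<open>n\<close> distinct
  roots, and neither factor has more roots than its degree, so both bounds are attained.\<close>

lemma minpoly_unity_card_roots:
  assumes "is_minpoly z M" "M dvd monom 1 n - 1" "n > 0"
  shows "card {w. rpoly M w = 0} = degree M"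
proof (rule antisym)
  have inj: "map_poly of_rat P = (0 :: complex poly) \<longleftrightarrow> P = 0" for P
    by (auto simp: poly_eq_iff coeff_map_poly)
  have deg: "degree (map_poly of_rat P :: complex poly) = degree P" for P
    by (auto intro: degree_map_poly)
  have le: "card {w. rpoly P w = 0} \<le> degree P" "finite {w. rpoly P w = 0}" if "P \<noteq> 0" for P
    using card_poly_roots_bound[of "map_poly of_rat P :: complex poly"]
      poly_roots_finite[of "map_poly of_rat P :: complex poly"] that inj deg
    by (auto simp: rpoly_def)
  obtain h where h: "monom 1 n - 1 = M * h" using assms(2) by blast
  have nz: "M \<noteq> 0" "h \<noteq> 0" using unity_poly_nonzero[OF assms(3)] h by auto
  have "n = card {w::complex. w ^ n = 1}" using card_roots_unity_eq assms by simp
  also have "{w::complex. w ^ n = 1} = {w. rpoly M w = 0} \<union> {w. rpoly h w = 0}"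
  proof -
    have "w ^ n - 1 = rpoly M w * rpoly h w" for w
      using arg_cong[OF h, of "\<lambda>P. rpoly P w"] by simp
    hence "w ^ n = 1 \<longleftrightarrow> rpoly M w = 0 \<or> rpoly h w = 0" for w
      by (metis eq_iff_diff_eq_0 mult_eq_0_iff)
    thus ?thesis by blast
  qed
  also have "card \<dots> \<le> card {w. rpoly M w = 0} + card {w. rpoly h w = 0}"
    by (rule card_Un_le)
  also have "\<dots> \<le> card {w. rpoly M w = 0} + degree h" using le nz by simp
  finally have "n \<le> card {w. rpoly M w = 0} + degree h" .
  moreover have "degree M + degree h = n"
  proof -
    have "degree (monom 1 n - 1 :: rat poly) = n"
      using degree_add_eq_left[of "-1" "monom 1 n :: rat poly"] assms(3)
      by (simp add: degree_monom_eq)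
    thus ?thesis using h nz by (simp add: degree_mult_eq)
  qed
  ultimately show "degree M \<le> card {w. rpoly M w = 0}" by simp
  show "card {w. rpoly M w = 0} \<le> degree M" using le nz by simp
qed

text \<open>This replaces Galois descent: modulo the minimal polynomial, \<open>P\<close> becomes a constant polynomial.\<close>

lemma constant_on_conjugates_imp_rational:
  assumes M: "is_minpoly z M" "M dvd monom 1 n - 1" "n > 0"
    and const: "\<And>w. rpoly M w = 0 \<Longrightarrow> rpoly P w = c"
  shows "c \<in> \<rat>"
proof -
  define Q where "Q = P mod M"
  have "rpoly Q w = c" if "rpoly M w = 0" for w
  proof -
    have "rpoly Q w = rpoly P w - rpoly M w * rpoly (P div M) w"
      by (simp flip: rpoly_mult rpoly_diff add: minus_mult_div_eq_mod Q_def)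
    thus ?thesis using const that by simp
  qed
  moreover have "degree Q < degree M"
    using degree_mod_less[of M P] minpoly_degree_pos[OF M(1)] M(1)
    by (auto simp: Q_def is_minpoly_def)
  moreover note minpoly_unity_card_roots[OF M] minpoly_degree_pos[OF M(1)]
  moreover have "degree (map_poly of_rat Q :: complex poly) = degree Q"
    by (auto intro: degree_map_poly)
  ultimately have "map_poly of_rat Q = [:c:]"
    by (intro poly_eqI_degree[where A = "{w. rpoly M w = 0}"]) (auto simp: rpoly_def)
  hence "c = of_rat (coeff Q 0)"
    by (metis coeff_map_poly coeff_pCons_0 of_rat_0)
  thus ?thesis by simp
qed

text \<open>Write \<open>x\<close> as the value of \<open>P\<close> at \<open>zeta n\<close>. That
  \<open>x\<close> is real and that it is a root of \<open>F\<close> are polynomial relations for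
  \<open>zeta n\<close>, so they hold for the value of \<open>P\<close> at every conjugate
  \<open>w\<close>. By uniqueness all these values equal \<open>x\<close>. This is where the field
  being abelian enters: conjugation has the same polynomial form at each \<open>w\<close>.\<close>

lemma real_cyclotomic_unique_root_rational:
  assumes n: "n > 0" and x: "x \<in> Qadj (zeta n)" "cnj x = x" and root: "rpoly F x = 0"
    and uniq: "\<And>y. cnj y = y \<Longrightarrow> rpoly F y = 0 \<Longrightarrow> y = x"
  shows "x \<in> \<rat>"
proof -
  obtain P where P: "x = rpoly P (zeta n)" using x by (auto simp: Qadj_def)
  obtain M where M: "is_minpoly (zeta n) M" "M dvd monom 1 n - 1" using zeta_minpoly n by blast
  have cnj: "cnj w = w ^ (n - 1)" if w: "w ^ n = 1" for w :: complex
  proof -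
    have "norm w ^ n = 1" using w by (metis norm_one norm_power)
    hence "norm w = 1" using n power_eq_1_iff by fastforce
    hence "w * cnj w = 1" by (simp add: complex_norm_square[symmetric])
    moreover have "w * w ^ (n - 1) = 1" using w n by (simp add: power_eq_if)
    ultimately show ?thesis by (metis mult_cancel_left mult_zero_left zero_neq_one)
  qed
  have transfer: "rpoly Q w = 0" if "rpoly M w = 0" "rpoly Q (zeta n) = 0" for Q w
    using that M by (auto simp: is_minpoly_def)
  have "rpoly P w = x" if w: "rpoly M w = 0" for w
  proof (rule uniq)
    have w1: "w ^ n = 1" using M(2) w by (metis dvdE eq_iff_diff_eq_0 mult_zero_left rpoly_mult rpoly_unity)
    let ?R = "P - pcompose P (monom 1 (n - 1))"
    have "rpoly ?R (zeta n) = x - cnj x"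
      using cnj[OF zeta_power[OF n]] by (simp add: rpoly_pcompose P cnj_rpoly)
    hence "rpoly ?R w = 0" using transfer[OF w, of ?R] x(2) by simp
    thus "cnj (rpoly P w) = rpoly P w"
      using cnj[OF w1] by (simp add: rpoly_pcompose) (metis cnj_rpoly)
    have "rpoly (pcompose F P) (zeta n) = 0" using root P by (simp add: rpoly_pcompose)
    thus "rpoly F (rpoly P w) = 0" using transfer w by (metis rpoly_pcompose)
  qed
  thus ?thesis using constant_on_conjugates_imp_rational M n by blast
qed

lemma Qadj_zeta_cnj:
  assumes "n > 0" "x \<in> Qadj (zeta n)" shows "cnj x \<in> Qadj (zeta n)"
proof -
  obtain P where P: "x = rpoly P (zeta n)" using assms by (auto simp: Qadj_def)
  have "cnj (zeta n) = zeta n ^ (n - 1)"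
  proof -
    have "zeta n * zeta n ^ (n - 1) = 1" using zeta_power assms by (simp add: power_eq_if)
    moreover have "zeta n * cnj (zeta n) = 1"
      by (simp add: zeta_def complex_norm_square[symmetric])
    ultimately show ?thesis by (metis mult_cancel_left mult_zero_left zero_neq_one)
  qed
  hence "cnj x = rpoly (pcompose P (monom 1 (n - 1))) (zeta n)"
    by (simp add: P cnj_rpoly rpoly_pcompose)
  thus ?thesis by (simp add: Qadj_def)
qed

section \<open>The ring generated by a root of unity\<close>

text \<open>Only multiplication by \<open>z\<close> is a rule, so inductions have no product case;
  closure under products is derived in \<open>Zadj_mult\<close>.\<close>

inductive_set Zadj :: "complex \<Rightarrow> complex set" for z where
  Zadj_one: "1 \<in> Zadj z"
| Zadj_step: "x \<in> Zadj z \<Longrightarrow> z * x \<in> Zadj z"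
| Zadj_add: "x \<in> Zadj z \<Longrightarrow> y \<in> Zadj z \<Longrightarrow> x + y \<in> Zadj z"
| Zadj_neg: "x \<in> Zadj z \<Longrightarrow> - x \<in> Zadj z"

lemma Zadj_zero: "0 \<in> Zadj z"
  using Zadj_add[OF Zadj_one Zadj_neg[OF Zadj_one]] by simp

lemma Zadj_gen: "z \<in> Zadj z"
  using Zadj_step[OF Zadj_one] by simp

lemma Zadj_diff: "x \<in> Zadj z \<Longrightarrow> y \<in> Zadj z \<Longrightarrow> x - y \<in> Zadj z"
  using Zadj_add[of x z "- y"] Zadj_neg by simp

lemma Zadj_mult: "x \<in> Zadj z \<Longrightarrow> y \<in> Zadj z \<Longrightarrow> x * y \<in> Zadj z"
  by (induction rule: Zadj.induct)
    (auto simp: distrib_right mult.assoc intro: Zadj_add Zadj_neg Zadj_step)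

lemma Zadj_power: "x \<in> Zadj z \<Longrightarrow> x ^ k \<in> Zadj z"
  by (induction k) (auto intro: Zadj_mult Zadj_one)

lemma Zadj_of_nat: "of_nat k \<in> Zadj z"
  by (induction k) (auto intro: Zadj_add Zadj_one Zadj_zero)

lemma Zadj_of_int: "of_int k \<in> Zadj z"
  by (cases k) (auto intro: Zadj_of_nat Zadj_neg simp del: of_nat_Suc)

lemma Zadj_sum: "(\<And>i. i \<in> A \<Longrightarrow> f i \<in> Zadj z) \<Longrightarrow> sum f A \<in> Zadj z"
  by (induction A rule: infinite_finite_induct) (auto intro: Zadj_add Zadj_zero)

lemma Zadj_prod: "(\<And>i. i \<in> A \<Longrightarrow> f i \<in> Zadj z) \<Longrightarrow> prod f A \<in> Zadj z"
  by (induction A rule: infinite_finite_induct) (auto intro: Zadj_mult Zadj_one)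

lemmas Zadj_intros = Zadj_zero Zadj_gen Zadj_diff Zadj_mult Zadj_power Zadj_of_nat Zadj_of_int
  Zadj_sum Zadj_prod Zadj_one Zadj_add Zadj_neg

lemma rat_times_nat_int: "\<exists>k>0. of_nat k * a \<in> \<int>" for a :: rat
proof (cases a)
  case (Fract u v)
  thus ?thesis
    by (intro exI[of _ "nat v"]) (auto simp: Fract_of_int_quotient)
qed

lemma poly_common_denominator:
  "\<exists>k>0. \<forall>i. of_nat k * coeff P i \<in> \<int>" for P :: "rat poly"
proof (induction P)
  case 0
  show ?case by (intro exI[of _ 1]) auto
next
  case (pCons a P)
  then obtain k where k: "k > 0" "\<And>i. of_nat k * coeff P i \<in> \<int>" by blast
  obtain l where l: "l > 0" "of_nat l * a \<in> \<int>" using rat_times_nat_int by blast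
  have "of_nat (k * l) * coeff (pCons a P) i \<in> \<int>" for i
  proof (cases i)
    case 0
    have "of_nat k * (of_nat l * a) \<in> \<int>" by (rule Ints_mult[OF Ints_of_nat l(2)])
    thus ?thesis using 0 by (simp add: algebra_simps)
  next
    case (Suc j)
    have "of_nat l * (of_nat k * coeff P j) \<in> \<int>" by (rule Ints_mult[OF Ints_of_nat k(2)])
    thus ?thesis using Suc by (simp add: algebra_simps)
  qed
  thus ?case using k l by (metis nat_0_less_mult_iff)
qed

lemma rpoly_int_in_Zadj:
  "(\<And>i. coeff P i \<in> \<int>) \<Longrightarrow> rpoly P z \<in> Zadj z"
proof (induction P)
  case (pCons a P)
  have "rpoly P z \<in> Zadj z"
    by (rule pCons.IH) (use pCons.prems[of "Suc i" for i] in simp)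
  moreover have "a \<in> \<int>" using pCons.prems[of 0] by simp
  then obtain u where "a = of_int u" by (auto elim: Ints_cases)
  ultimately show ?case by (auto intro: Zadj_intros)
qed (auto intro: Zadj_intros)

lemma Qadj_imp_Zadj_multiple:
  assumes "x \<in> Qadj z" shows "\<exists>k>0. of_nat k * x \<in> Zadj z"
proof -
  obtain P where P: "x = rpoly P z" using assms by (auto simp: Qadj_def)
  obtain k where k: "k > 0" "\<And>i. of_nat k * coeff P i \<in> \<int>" using poly_common_denominator by blast
  have "rpoly (smult (of_nat k) P) z \<in> Zadj z" by (rule rpoly_int_in_Zadj) (use k in simp)
  thus ?thesis using k P by auto
qed

text \<open>The ring is contained in a lattice \<open>1/N \<Sum> \<int> z\<^sup>i\<close> with \<open>i\<close> below the degree of \<open>z\<close>, and no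
  such lattice contains all powers of \<open>1/p\<close>.\<close>

lemma Zadj_no_inverse_of_nat:
  assumes M: "is_minpoly z M" and n: "z ^ n = 1" "n > 0" and x: "x \<in> Zadj z" and p: "p \<ge> (2 :: nat)"
  shows "of_nat p * x \<noteq> 1"
proof
  assume px: "of_nat p * x = 1"
  define L where "L N = {x. \<exists>R. (\<forall>i. coeff R i \<in> \<int>) \<and> degree R < degree M \<and>
    of_nat N * x = rpoly R z}" for N :: nat
  have L_mult: "x \<in> L (N * N')" if x: "x \<in> L N" for x N N'
  proof -
    obtain R where R: "\<And>i. coeff R i \<in> \<int>" "degree R < degree M" "of_nat N * x = rpoly R z"
      using x by (auto simp: L_def)
    have "rpoly (smult (of_nat N') R) z = of_nat (N * N') * x"
      using R(3) by (simp add: algebra_simps)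
    moreover have "coeff (smult (of_nat N') R) i \<in> \<int>" for i using R(1) by simp
    moreover have "degree (smult (of_nat N') R) < degree M"
      using R(2) degree_smult_le le_less_trans by blast
    ultimately show ?thesis unfolding L_def by (intro CollectI exI[of _ "smult (of_nat N') R"]) auto
  qed
  have "\<exists>N>0. z ^ j \<in> L N" for j
  proof -
    define R where "R = monom 1 j mod M"
    obtain k where k: "k > 0" "\<And>i. of_nat k * coeff R i \<in> \<int>"
      using poly_common_denominator by blast
    have "rpoly M z = 0" using M by (auto simp: is_minpoly_def)
    moreover have "rpoly R z = rpoly (monom 1 j) z - rpoly M z * rpoly (monom 1 j div M) z"
      unfolding R_def by (simp only: minus_mult_div_eq_mod flip: rpoly_mult rpoly_diff)
    ultimately have "rpoly R z = z ^ j" by simp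
    hence "rpoly (smult (of_nat k) R) z = of_nat k * z ^ j" by simp
    moreover have "degree R < degree M"
      using degree_mod_less[of M "monom 1 j"] minpoly_degree_pos[OF M] M
      by (auto simp: R_def is_minpoly_def)
    hence "degree (smult (of_nat k) R) < degree M"
      using degree_smult_le le_less_trans by blast
    moreover have "coeff (smult (of_nat k) R) i \<in> \<int>" for i using k by simp
    ultimately have "z ^ j \<in> L k"
      unfolding L_def by (intro CollectI exI[of _ "smult (of_nat k) R"]) auto
    thus ?thesis using k(1) by blast
  qed
  then obtain f where f: "\<And>j. f j > 0" "\<And>j. z ^ j \<in> L (f j)" by metis
  \<comment> \<open>The powers of \<open>z\<close> have period \<open>n\<close>, so a common
    multiple of \<open>n\<close> denominators serves all of them.\<close>
  define N where "N = (\<Prod>j<n. f j)"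
  have N0: "N > 0" using f unfolding N_def by (simp add: prod_pos)
  have zj: "z ^ j \<in> L N" for j
  proof -
    have "j mod n < n" using n by simp
    hence "N = f (j mod n) * (\<Prod>j\<in>{..<n} - {j mod n}. f j)"
      unfolding N_def by (intro prod.remove) auto
    hence "z ^ (j mod n) \<in> L N" using L_mult[OF f(2)] by (simp only:)
    moreover have "z ^ j = z ^ (j mod n)"
    proof -
      have "z ^ j = (z ^ n) ^ (j div n) * z ^ (j mod n)"
        by (simp flip: power_mult power_add)
      thus ?thesis using n by simp
    qed
    ultimately show ?thesis by simp
  qed
  have "\<forall>i. z ^ i * y \<in> L N" if "y \<in> Zadj z" for y
    using that
  proof induction
    case Zadj_one
    show ?case using zj by simp
  next
    case (Zadj_step x)
    show ?case
    proof
      fix i show "z ^ i * (z * x) \<in> L N"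
        using Zadj_step.IH[THEN spec, of "Suc i"] by (simp add: mult_ac)
    qed
  next
    case (Zadj_add x y)
    show ?case
    proof
      fix i
      obtain R S where "\<And>i. coeff R i \<in> \<int>" "degree R < degree M" "of_nat N * (z ^ i * x) = rpoly R z"
        "\<And>i. coeff S i \<in> \<int>" "degree S < degree M" "of_nat N * (z ^ i * y) = rpoly S z"
        using Zadj_add.IH[THEN spec, of i] by (auto simp: L_def)
      thus "z ^ i * (x + y) \<in> L N"
        unfolding L_def by (intro CollectI exI[of _ "R + S"])
          (auto simp: distrib_left intro: degree_add_less)
    qed
  next
    case (Zadj_neg x)
    show ?case
    proof
      fix i
      obtain R where "\<And>i. coeff R i \<in> \<int>" "degree R < degree M" "of_nat N * (z ^ i * x) = rpoly R z"
        using Zadj_neg.IH[THEN spec, of i] by (auto simp: L_def)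
      thus "z ^ i * - x \<in> L N"
        unfolding L_def by (intro CollectI exI[of _ "- R"]) auto
    qed
  qed
  \<comment> \<open>\<open>x\<close> is the inverse of \<open>p\<close>; the exponent
    \<open>N\<close> is taken because \<open>p ^ N\<close> exceeds the denominator \<open>N\<close>
    of the lattice.\<close>
  from this[OF Zadj_power[OF x, of N], THEN spec, of 0] have "x ^ N \<in> L N" by simp
  then obtain R where R: "\<And>i. coeff R i \<in> \<int>" "degree R < degree M" "of_nat N * x ^ N = rpoly R z"
    by (auto simp: L_def)
  have "of_nat N = of_nat N * (of_nat p * x) ^ N" using px by simp
  also have "\<dots> = of_nat (p ^ N) * (of_nat N * x ^ N)" by (simp add: power_mult_distrib)
  also note R(3)
  finally have eqN: "of_nat N = of_nat (p ^ N) * rpoly R z" .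
  \<comment> \<open>A relation for \<open>z\<close> of degree below \<open>degree M\<close> is
    trivial, which permits comparing constant terms.\<close>
  define T where "T = smult (of_nat (p ^ N)) R - [:of_nat N:]"
  have "rpoly T z = of_nat (p ^ N) * rpoly R z - of_nat N"
    unfolding T_def rpoly_diff rpoly_smult by (simp only: of_rat_of_nat_eq rpoly_pCons rpoly_0 mult_zero_right add_0_right)
  hence "rpoly T z = 0" using eqN by (simp only: diff_self)
  hence dvd: "M dvd T" using M by (simp only: is_minpoly_def)
  have deg: "degree T < degree M"
    unfolding T_def using le_less_trans[OF degree_smult_le R(2)] R(2) by (intro degree_diff_less) auto
  have "T = 0"
  proof (rule ccontr)
    assume "T \<noteq> 0"
    from dvd_imp_degree_le[OF dvd this] deg show False by simp
  qed
  hence "coeff T 0 = 0" by simp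
  hence eq: "of_nat (p ^ N) * coeff R 0 = of_nat N" unfolding T_def by simp
  obtain u where u: "coeff R 0 = of_int u" using R(1) by (metis Ints_cases)
  have "int (p ^ N) * u = int N"
  proof -
    have "of_int (int (p ^ N) * u) = (of_int (int N) :: rat)"
      using eq u by simp
    thus ?thesis by (simp only: of_int_eq_iff)
  qed
  hence "int (p ^ N) dvd int N" by (metis dvd_triv_left)
  hence "p ^ N dvd N" by (simp only: of_nat_dvd_iff)
  hence "p ^ N \<le> N" using N0 by (simp add: dvd_imp_le)
  moreover have "N < p ^ N" using p by (simp add: power_gt_expt)
  ultimately show False by simp
qed

section \<open>Prime ideals\<close>

definition prime_ideal_of :: "complex \<Rightarrow> complex set \<Rightarrow> bool" where
  "prime_ideal_of z I \<longleftrightarrow> I \<subseteq> Zadj z \<and> 1 \<notin> I \<and> (\<forall>x\<in>I. \<forall>y\<in>I. x + y \<in> I) \<and>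
    (\<forall>x\<in>Zadj z. \<forall>y\<in>I. x * y \<in> I) \<and> (\<forall>x\<in>Zadj z. \<forall>y\<in>Zadj z. x * y \<in> I \<longrightarrow> x \<in> I \<or> y \<in> I)"

lemma prime_ideal_ofD:
  assumes "prime_ideal_of z I"
  shows "I \<subseteq> Zadj z" "1 \<notin> I" "x \<in> I \<Longrightarrow> y \<in> I \<Longrightarrow> x + y \<in> I"
    "x \<in> Zadj z \<Longrightarrow> y \<in> I \<Longrightarrow> x * y \<in> I"
    "x \<in> Zadj z \<Longrightarrow> y \<in> Zadj z \<Longrightarrow> x * y \<in> I \<Longrightarrow> x \<in> I \<or> y \<in> I"
  using assms by (auto simp: prime_ideal_of_def)

text \<open>By Zorn there is an ideal maximal among those that contain \<open>a\<close> and avoid 1;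
  the multiples of \<open>a\<close> are one of these because \<open>a\<close> has no inverse.
  Maximal ideals are prime.\<close>

lemma Zadj_prime_ideal_exists:
  assumes no_inv: "\<And>x. x \<in> Zadj z \<Longrightarrow> a * x \<noteq> 1" and a: "a \<in> Zadj z"
  shows "\<exists>I. prime_ideal_of z I \<and> a \<in> I"
proof -
  let ?O = "Zadj z"
  define A where "A = {I. I \<subseteq> ?O \<and> a \<in> I \<and> 1 \<notin> I \<and> (\<forall>x\<in>I. \<forall>y\<in>I. x + y \<in> I) \<and>
    (\<forall>x\<in>?O. \<forall>y\<in>I. x * y \<in> I)}"
  have "(\<lambda>x. a * x) ` ?O \<in> A"
  proof -
    have "a \<in> (\<lambda>x. a * x) ` ?O" by (rule image_eqI[of _ _ 1]) (auto intro: Zadj_intros)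
    moreover have "a * x + a * y \<in> (\<lambda>x. a * x) ` ?O" if "x \<in> ?O" "y \<in> ?O" for x y
      by (rule image_eqI[of _ _ "x + y"]) (use that in \<open>auto simp: distrib_left intro: Zadj_intros\<close>)
    moreover have "x * (a * y) \<in> (\<lambda>x. a * x) ` ?O" if "x \<in> ?O" "y \<in> ?O" for x y
      by (rule image_eqI[of _ _ "x * y"]) (use that in \<open>auto simp: algebra_simps intro: Zadj_intros\<close>)
    moreover have "1 \<notin> (\<lambda>x. a * x) ` ?O" using no_inv by force
    moreover have "(\<lambda>x. a * x) ` ?O \<subseteq> ?O" using a by (auto intro: Zadj_mult)
    ultimately show ?thesis unfolding A_def by auto
  qed
  hence "A \<noteq> {}" by blast
  moreover have "\<Union>C \<in> A" if "C \<noteq> {}" "subset.chain A C" for C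
  proof -
    have C: "\<And>I. I \<in> C \<Longrightarrow> I \<in> A" "\<And>I J. I \<in> C \<Longrightarrow> J \<in> C \<Longrightarrow> I \<subseteq> J \<or> J \<subseteq> I"
      using that unfolding subset.chain_def by auto
    have "x + y \<in> \<Union>C" if xy: "x \<in> \<Union>C" "y \<in> \<Union>C" for x y
    proof -
      obtain I J where IJ: "I \<in> C" "x \<in> I" "J \<in> C" "y \<in> J" using xy by blast
      then obtain K where "K \<in> C" "x \<in> K" "y \<in> K" using C(2) by blast
      thus ?thesis using C(1)[of K] by (auto simp: A_def)
    qed
    moreover have C': "I \<subseteq> ?O" "1 \<notin> I" "a \<in> I" "\<forall>x\<in>?O. \<forall>y\<in>I. x * y \<in> I" if "I \<in> C" for I
      using C(1)[OF that] by (simp_all add: A_def)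
    moreover have "\<Union>C \<subseteq> ?O" using C'(1) by blast
    moreover have "1 \<notin> \<Union>C" using C'(2) by blast
    moreover have "a \<in> \<Union>C" using C'(3) that(1) by blast
    moreover have "\<forall>x\<in>?O. \<forall>y\<in>\<Union>C. x * y \<in> \<Union>C" using C'(4) by blast
    ultimately show ?thesis unfolding A_def by simp
  qed
  ultimately obtain I where I: "I \<in> A" "\<And>J. J \<in> A \<Longrightarrow> I \<subseteq> J \<Longrightarrow> J = I"
    using subset_Zorn_nonempty[of A] by blast
  have I': "I \<subseteq> ?O" "a \<in> I" "1 \<notin> I" "\<And>x y. x \<in> I \<Longrightarrow> y \<in> I \<Longrightarrow> x + y \<in> I"
    "\<And>x y. x \<in> ?O \<Longrightarrow> y \<in> I \<Longrightarrow> x * y \<in> I"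
    using I(1) by (auto simp: A_def)
  have zero: "0 \<in> I" using I'(5)[of 0 a] I'(2) Zadj_zero by simp
  have bez: "\<exists>i\<in>I. \<exists>y\<in>?O. 1 = i + x * y" if x: "x \<in> ?O" "x \<notin> I" for x
  proof (rule ccontr)
    assume no: "\<not> ?thesis"
    define J where "J = {i + x * y | i y. i \<in> I \<and> y \<in> ?O}"
    have sub: "I \<subseteq> J"
    proof
      fix i assume "i \<in> I"
      moreover have "i = i + x * 0" by simp
      ultimately show "i \<in> J" unfolding J_def using Zadj_zero by blast
    qed
    have "x = 0 + x * 1" by simp
    hence "x \<in> J" unfolding J_def using zero Zadj_one by blast
    moreover have "J \<in> A"
    proof -
      have "u + v \<in> J" if "u \<in> J" "v \<in> J" for u v
      proof -
        obtain i y j y' where "u = i + x * y" "v = j + x * y'" "i \<in> I" "j \<in> I" "y \<in> ?O" "y' \<in> ?O"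
          using \<open>u \<in> J\<close> \<open>v \<in> J\<close> unfolding J_def by blast
        hence "u + v = (i + j) + x * (y + y')" "i + j \<in> I" "y + y' \<in> ?O"
          by (auto simp: algebra_simps intro: Zadj_intros I')
        thus ?thesis unfolding J_def by blast
      qed
      moreover have "u * v \<in> J" if "u \<in> ?O" "v \<in> J" for u v
      proof -
        obtain j y' where "v = j + x * y'" "j \<in> I" "y' \<in> ?O"
          using \<open>v \<in> J\<close> unfolding J_def by blast
        hence "u * v = u * j + x * (u * y')" "u * j \<in> I" "u * y' \<in> ?O"
          using \<open>u \<in> ?O\<close> by (auto simp: distrib_left mult_ac(3) intro: Zadj_mult I')
        thus ?thesis unfolding J_def by blast
      qed
      moreover have "J \<subseteq> ?O" using I'(1) x unfolding J_def by (auto intro!: Zadj_intros)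
      moreover have "a \<in> J" using sub I' by blast
      moreover have "1 \<notin> J" using no unfolding J_def by blast
      ultimately show ?thesis unfolding A_def by simp
    qed
    ultimately show False using I(2)[OF _ sub] x by blast
  qed
  have "x \<in> I \<or> y \<in> I" if xy: "x \<in> ?O" "y \<in> ?O" "x * y \<in> I" for x y
  proof (rule ccontr)
    assume "\<not> ?thesis"
    then obtain i u j v where *: "i \<in> I" "u \<in> ?O" "1 = i + x * u" "j \<in> I" "v \<in> ?O" "1 = j + y * v"
      using bez xy by metis
    have "1 = (i + x * u) * (j + y * v)" using *(3,6) by simp
    also have "\<dots> = j * i + (y * v) * i + (x * u) * j + (u * v) * (x * y)" by (simp add: algebra_simps)
    also have "\<dots> \<in> I"
    proof -
      have "j * i \<in> I" "(y * v) * i \<in> I" "(x * u) * j \<in> I" "(u * v) * (x * y) \<in> I"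
        using * I'(1) xy by (auto intro!: I'(5) intro: Zadj_mult)
      thus ?thesis by (intro I'(4))
    qed
    finally show False using I' by simp
  qed
  thus ?thesis using I' by (intro exI[of _ I]) (simp add: prime_ideal_of_def)
qed

section \<open>Congruences and the Frobenius map\<close>

lemma Zadj_frobenius:
  assumes p: "prime p" and xy: "x \<in> Zadj z" "y \<in> Zadj z"
  shows "\<exists>c\<in>Zadj z. (x + y) ^ p = x ^ p + y ^ p + of_nat p * c"
proof -
  define f where "f k = (p choose k) div p" for k
  have f: "p choose k = p * f k" if "k \<in> {0<..<p}" for k
    unfolding f_def using that dvd_choose_prime[of k p] p by auto
  have p0: "p > 0" using p prime_gt_0_nat by blast
  let ?t = "\<lambda>k. of_nat (p choose k) * x ^ k * y ^ (p - k)"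
  have "(x + y) ^ p = sum ?t {..p}" by (simp add: binomial_ring)
  also have "{..p} = insert 0 (insert p {0<..<p})" using p0 by auto
  also have "sum ?t \<dots> = y ^ p + x ^ p + sum ?t {0<..<p}" using p0 by simp
  also have "sum ?t {0<..<p} = of_nat p * (\<Sum>k\<in>{0<..<p}. of_nat (f k) * x ^ k * y ^ (p - k))"
    unfolding sum_distrib_left by (rule sum.cong) (auto simp: f algebra_simps)
  finally show ?thesis using xy
    by (intro bexI[of _ "\<Sum>k\<in>{0<..<p}. of_nat (f k) * x ^ k * y ^ (p - k)"])
      (auto intro!: Zadj_intros simp: algebra_simps)
qed

text \<open>Congruence modulo the ideal generated by \<open>a\<close>. Nothing places
  \<open>x\<close> and \<open>y\<close> themselves in the ring, hence the membership hypotheses of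
  \<open>Zcong_mult\<close>.\<close>

definition Zcong :: "complex \<Rightarrow> complex \<Rightarrow> complex \<Rightarrow> complex \<Rightarrow> bool" where
  "Zcong z a x y \<longleftrightarrow> (\<exists>c\<in>Zadj z. x = y + a * c)"

lemma Zcong_refl: "Zcong z a x x"
  unfolding Zcong_def by (intro bexI[of _ 0]) (auto intro: Zadj_intros)

lemma Zcong_sym: "Zcong z a x y \<Longrightarrow> Zcong z a y x"
  unfolding Zcong_def
proof (elim bexE)
  fix c assume "c \<in> Zadj z" "x = y + a * c"
  thus "\<exists>c\<in>Zadj z. y = x + a * c" by (intro bexI[of _ "- c"]) (auto intro: Zadj_neg)
qed

lemma Zcong_trans: "Zcong z a x y \<Longrightarrow> Zcong z a y t \<Longrightarrow> Zcong z a x t"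
  unfolding Zcong_def
proof (elim bexE)
  fix c d assume "c \<in> Zadj z" "x = y + a * c" "d \<in> Zadj z" "y = t + a * d"
  thus "\<exists>c\<in>Zadj z. x = t + a * c"
    by (intro bexI[of _ "c + d"]) (auto simp: algebra_simps intro: Zadj_add)
qed

lemma Zcong_add: "Zcong z a x y \<Longrightarrow> Zcong z a x' y' \<Longrightarrow> Zcong z a (x + x') (y + y')"
proof -
  assume "Zcong z a x y" "Zcong z a x' y'"
  then obtain c d where "c \<in> Zadj z" "d \<in> Zadj z" "x = y + a * c" "x' = y' + a * d"
    by (auto simp: Zcong_def)
  thus ?thesis unfolding Zcong_def
    by (intro bexI[of _ "c + d"]) (auto simp: algebra_simps intro: Zadj_intros)
qed

lemma Zcong_mult:
  assumes "Zcong z a x y" "Zcong z a x' y'" "y \<in> Zadj z" "y' \<in> Zadj z" "a \<in> Zadj z"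
  shows "Zcong z a (x * x') (y * y')"
proof -
  obtain c d where "c \<in> Zadj z" "d \<in> Zadj z" "x = y + a * c" "x' = y' + a * d"
    using assms by (auto simp: Zcong_def)
  thus ?thesis unfolding Zcong_def using assms
    by (intro bexI[of _ "y * d + y' * c + a * c * d"]) (auto simp: algebra_simps intro!: Zadj_intros)
qed

lemma Zcong_power:
  assumes "Zcong z a x y" "y \<in> Zadj z" "a \<in> Zadj z"
  shows "Zcong z a (x ^ k) (y ^ k)"
  by (induction k) (auto intro: Zcong_refl Zcong_mult assms Zadj_power)

lemma Zcong_coarsen: "Zcong z (a * b) x y \<Longrightarrow> b \<in> Zadj z \<Longrightarrow> Zcong z a x y"
  unfolding Zcong_def by (metis Zadj_mult mult.assoc)

lemma Zcong_frobenius: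
  assumes p: "prime p" and xy: "x \<in> Zadj z" "y \<in> Zadj z"
  shows "Zcong z (of_nat p) ((x + y) ^ (p ^ r)) (x ^ (p ^ r) + y ^ (p ^ r))"
proof (induction r)
  case 0
  show ?case by (simp add: Zcong_refl)
next
  case (Suc r)
  have "Zcong z (of_nat p) (((x + y) ^ (p ^ r)) ^ p) ((x ^ (p ^ r) + y ^ (p ^ r)) ^ p)"
    by (intro Zcong_power Suc) (use xy in \<open>auto intro!: Zadj_intros\<close>)
  moreover have "Zcong z (of_nat p) ((x ^ (p ^ r) + y ^ (p ^ r)) ^ p) ((x ^ (p ^ r)) ^ p + (y ^ (p ^ r)) ^ p)"
    using Zadj_frobenius[OF p, of "x ^ (p ^ r)" z "y ^ (p ^ r)"] xy
    by (auto simp: Zcong_def intro: Zadj_power)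
  ultimately show ?case
    using Zcong_trans by (auto simp: power_mult[symmetric] mult.commute)
qed

section \<open>A valuation with known ramification\<close>

lemma power_mod_period: "w ^ q = 1 \<Longrightarrow> w ^ j = w ^ (j mod q)" for w :: complex
proof -
  assume q: "w ^ q = 1"
  have "w ^ j = (w ^ q) ^ (j div q) * w ^ (j mod q)"
    by (simp flip: power_mult power_add)
  thus ?thesis by (simp only: q power_one mult_1)
qed

lemma zeta_power_inj:
  assumes "n > 0" "i < n" "j < n" "zeta n ^ i = zeta n ^ j"
  shows "i = j"
proof -
  have "zeta n ^ k = cis (2 * pi * real k / real n)" for k
    by (simp add: zeta_def DeMoivre algebra_simps)
  thus ?thesis
    using bij_betw_roots_unity[OF assms(1)] assms unfolding bij_betw_def inj_on_def by auto
qed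

text \<open>The value at \<open>1\<close> of the cyclotomic polynomial of order \<open>p ^ Suc r\<close>.\<close>

lemma prod_totatives_one_minus_zeta:
  assumes p: "prime p"
  shows "(\<Prod>k\<in>totatives (p ^ Suc r). 1 - zeta (p ^ Suc r) ^ k) = of_nat p"
proof -
  define q where "q = p ^ Suc r"
  define w where "w = zeta q"
  define E where "E = p ^ r * (p - 1)"
  have p1: "p > 1" using p prime_gt_1_nat by blast
  have q1: "q > 1" using p1 unfolding q_def by (metis one_less_power zero_less_Suc)
  define G where "G = totatives q"
  have cardG: "card G = E"
    using totient_prime_power_Suc[OF p, of r] by (simp add: G_def q_def E_def totient_def)
  have Glt: "k < q" if "k \<in> G" for k using totatives_less that q1 by (simp add: G_def)
  have inj: "inj_on (\<lambda>k. w ^ k) G"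
    using zeta_power_inj q1 Glt by (auto simp: inj_on_def w_def)
  have wq: "w ^ q = 1" using zeta_power q1 by (simp add: w_def)
  \<comment> \<open>\<open>F\<close> is \<open>(X^q - 1) / (X^(q/p) - 1)\<close>, and
    \<open>H\<close> is its factorization over the primitive roots of unity of order
    \<open>q\<close>. Both have degree at most \<open>E\<close>, the same coefficient there and
    \<open>E\<close> common zeros. At 1, \<open>F\<close> counts its \<open>p\<close> terms.\<close>
  define F :: "complex poly" where "F = (\<Sum>j<p. monom 1 (j * p ^ r))"
  define H where "H = (\<Prod>k\<in>G. [:- (w ^ k), 1:])"
  have degH: "degree H = E"
    unfolding H_def by (subst degree_prod_eq_sum_degree) (auto simp: cardG)
  have "F = H"
  proof (rule poly_eqI_degree_lead_coeff[where n = E and A = "(\<lambda>k. w ^ k) ` G"])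
    have "j = p - 1" if "j < p" "j * p ^ r = E" for j
      using that p1 by (simp add: E_def)
    hence "coeff F E = (\<Sum>j<p. if j = p - 1 then 1 else 0)"
      unfolding F_def by (auto simp: coeff_sum E_def intro!: sum.cong)
    also have "\<dots> = 1" using p1 by simp
    also have "1 = lead_coeff H" unfolding H_def by (subst lead_coeff_prod) simp
    finally show "coeff F E = coeff H E" by (simp add: degH)
    show "E \<le> card ((\<lambda>k. w ^ k) ` G)" using inj by (simp add: card_image cardG)
    show "degree F \<le> E"
      unfolding F_def
    proof (rule degree_sum_le)
      fix j assume "j \<in> {..<p}"
      hence "j * p ^ r \<le> E" using p1 by (simp add: E_def)
      thus "degree (monom (1::complex) (j * p ^ r)) \<le> E" by (simp add: degree_monom_eq)
    qed simp
    show "degree H \<le> E" by (simp add: degH)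
    fix x assume "x \<in> (\<lambda>k. w ^ k) ` G"
    then obtain k where k: "k \<in> G" "x = w ^ k" by blast
    have "poly H x = 0" using k unfolding H_def by (auto simp: poly_prod G_def)
    moreover have "poly F x = 0"
    proof -
      \<comment> \<open>A root of unity of order \<open>p\<close>, different from 1 as
        \<open>p\<close> does not divide \<open>k\<close>; its geometric sum is the value of
        \<open>F\<close> at \<open>x\<close>.\<close>
      define y where "y = x ^ (p ^ r)"
      have "y ^ p = (w ^ q) ^ k"
        by (simp add: y_def k q_def mult_ac flip: power_mult)
      hence yp: "y ^ p = 1" using wq by simp
      have y1: "y \<noteq> 1"
      proof
        assume "y = 1"
        hence "w ^ (k * p ^ r) = 1" by (simp add: y_def k power_mult)
        moreover have "w ^ (k * p ^ r) = w ^ (k * p ^ r mod q)"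
          by (rule power_mod_period[OF wq])
        ultimately have "w ^ (k * p ^ r mod q) = w ^ 0" by simp
        hence "k * p ^ r mod q = 0"
          using zeta_power_inj[of q "k * p ^ r mod q" 0] q1 by (simp add: w_def)
        hence "p * p ^ r dvd k * p ^ r" by (simp add: q_def mod_eq_0_iff_dvd)
        hence "p dvd k" using p1 by simp
        moreover have "coprime k p" using k(1) by (simp add: G_def in_totatives_iff q_def)
        ultimately show False using p1 by (metis coprime_common_divisor_nat dvd_refl less_irrefl)
      qed
      have "poly F x = (\<Sum>j<p. y ^ j)"
        unfolding F_def y_def by (auto simp: poly_sum poly_monom mult.commute simp flip: power_mult)
      also have "(1 - y) * \<dots> = 1 - y ^ p" by (simp add: one_diff_power_eq)
      hence "(\<Sum>j<p. y ^ j) = 0" using yp y1 by simp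
      finally show ?thesis .
    qed
    ultimately show "poly F x = poly H x" by simp
  qed
  hence "poly F 1 = poly H 1" by simp
  thus ?thesis by (simp add: F_def H_def poly_sum poly_monom poly_prod G_def w_def q_def)
qed

section \<open>A prime ideal above \<open>p\<close> in a cyclotomic ring, and its valuation\<close>

locale cyclotomic_prime =
  fixes p r m :: nat
  assumes p: "prime p" and m: "\<not> p dvd m"
begin

text \<open>\<open>Suc r\<close> keeps at least one factor \<open>p\<close>, so that the
  ramification index has the uniform shape \<open>E\<close>.\<close>

definition n where "n = p ^ Suc r * m"
definition z where "z = zeta n"
text \<open>\<open>z ^ m\<close> is a primitive root of unity of order \<open>p ^ Suc r\<close>;
  \<open>l\<close> will be a uniformizer at a prime above \<open>p\<close>.\<close>

definition l where "l = 1 - z ^ m"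
definition E where "E = p ^ r * (p - 1)"

abbreviation R where "R \<equiv> Zadj z"

lemma p1: "p > 1" using p prime_gt_1_nat by blast

lemma m0: "m > 0" using m by (cases m) auto

lemma n0: "n > 0" using p1 m0 by (simp add: n_def)

lemma E0: "E > 0" using p1 by (simp add: E_def)

lemma zm: "z ^ m = zeta (p ^ Suc r)"
  unfolding z_def n_def by (rule zeta_mult_power) (use p1 m0 in auto)

lemma zn: "z ^ n = 1" unfolding z_def by (rule zeta_power[OF n0])

lemma l_in: "l \<in> R" unfolding l_def by (intro Zadj_intros)

text \<open>The cofactor in \<open>p = l^E g\<close>: the product of
  \<open>(1 - w^k) / (1 - w)\<close> for \<open>w = z ^ m\<close>. It is a unit at the chosen
  prime.\<close>

definition g where "g = (\<Prod>k\<in>totatives (p ^ Suc r). \<Sum>j<k. (z ^ m) ^ j)"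

lemma g_in: "g \<in> R" unfolding g_def by (intro Zadj_intros)

lemma p_eq: "of_nat p = l ^ E * g"
proof -
  have "of_nat p = (\<Prod>k\<in>totatives (p ^ Suc r). l * (\<Sum>j<k. (z ^ m) ^ j))"
    using prod_totatives_one_minus_zeta[OF p, of r] by (simp add: one_diff_power_eq l_def zm)
  also have "\<dots> = l ^ card (totatives (p ^ Suc r)) * g"
    by (simp add: prod.distrib g_def)
  also have "card (totatives (p ^ Suc r)) = E"
    using totient_prime_power_Suc[OF p, of r] by (simp add: E_def totient_def)
  finally show ?thesis .
qed

lemma p_in_l: "\<exists>c\<in>R. of_nat p = l * c"
proof -
  obtain e where "E = Suc e" using E0 by (cases E) auto
  hence "of_nat p = l * (l ^ e * g)" using p_eq by simp
  moreover have "l ^ e * g \<in> R" using l_in g_in by (intro Zadj_mult Zadj_power)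
  ultimately show ?thesis by blast
qed

lemma Zcong_p_imp_l: "Zcong z (of_nat p) x y \<Longrightarrow> Zcong z l x y"
  using p_in_l Zcong_coarsen by metis

lemma l_nz: "l \<noteq> 0"
  using p_in_l p1 by auto

text \<open>Take \<open>q\<close> a power of \<open>p\<close> congruent to 1 modulo
  \<open>m\<close>. Modulo \<open>l\<close>, the map \<open>x ^ q\<close> is additive because
  \<open>l\<close> divides \<open>p\<close>, and it fixes \<open>z\<close> because
  \<open>z ^ m\<close> is congruent to 1. It follows that the quotient by \<open>l\<close> is
  reduced, which is what makes \<open>l\<close> a local generator of the prime ideal.\<close>

lemma frobenius_fixes:
  "\<exists>q>1. \<forall>x\<in>R. Zcong z l (x ^ q) x"
proof -
  define t where "t = totient m"
  have t0: "t > 0" using m0 by (simp add: t_def)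
  define q where "q = p ^ t"
  have q1: "q > 1" unfolding q_def by (rule one_less_power[OF p1 t0])
  have "coprime p m" using p m by (simp add: prime_imp_coprime)
  hence "[q = 1] (mod m)" unfolding q_def t_def by (rule euler_theorem)
  hence "m dvd q - 1" using q1 by (simp add: cong_altdef_nat cong_sym_eq)
  then obtain c where c: "q - 1 = m * c" by blast
  have zq: "Zcong z l (z ^ q) z"
  proof -
    have "1 - (z ^ m) ^ c = l * (\<Sum>j<c. (z ^ m) ^ j)" by (simp add: one_diff_power_eq l_def)
    hence "(z ^ m) ^ c = 1 + l * - (\<Sum>j<c. (z ^ m) ^ j)" by (simp add: algebra_simps)
    moreover have "- (\<Sum>j<c. (z ^ m) ^ j) \<in> R" by (intro Zadj_intros)
    ultimately have "Zcong z l (z ^ (q - 1)) 1"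
      unfolding Zcong_def c power_mult by blast
    hence "Zcong z l (z * z ^ (q - 1)) (z * 1)"
      by (intro Zcong_mult Zcong_refl l_in Zadj_intros)
    moreover have "z * z ^ (q - 1) = z ^ q" using q1 by (cases q) auto
    ultimately show ?thesis by simp
  qed
  have fr: "Zcong z l ((x + y) ^ q) (x ^ q + y ^ q)" if "x \<in> R" "y \<in> R" for x y
    unfolding q_def by (intro Zcong_p_imp_l Zcong_frobenius p that)
  have "Zcong z l (x ^ q) x" if "x \<in> R" for x
    using that
  proof induction
    case Zadj_one
    show ?case by (simp add: Zcong_refl)
  next
    case (Zadj_step x)
    show ?case unfolding power_mult_distrib
      by (intro Zcong_mult zq Zadj_step l_in Zadj_gen)
  next
    case (Zadj_add x y)
    show ?case using Zcong_trans[OF fr Zcong_add] Zadj_add by blast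
  next
    case (Zadj_neg x)
    \<comment> \<open>\<open>q\<close> may be even, so the sign is handled by additivity applied to
      \<open>x + - x\<close>.\<close>
    have "Zcong z l ((x + - x) ^ q) (x ^ q + (- x) ^ q)" using fr Zadj_neg Zadj.Zadj_neg by blast
    moreover have "(x + - x) ^ q = 0" using q1 by (simp add: zero_power)
    ultimately have "Zcong z l (x ^ q + (- x) ^ q) 0" using Zcong_sym by metis
    from Zcong_add[OF this Zcong_sym[OF Zcong_add[OF Zadj_neg.IH Zcong_refl[of _ _ "- x"]]]]
    have 1: "Zcong z l ((x ^ q + (- x) ^ q) + (x + - x)) (0 + (x ^ q + - x))" .
    from Zcong_add[OF 1 Zcong_refl[of _ _ "- (x ^ q)"]]
    show ?case by simp
  qed
  with q1 show ?thesis by blast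
qed

text \<open>\<open>p\<close> has no inverse in the ring, so some prime ideal contains it. Modulo
  \<open>p\<close> the power \<open>l ^ (p ^ Suc r)\<close> is \<open>1 - 1\<close>, so
  \<open>l\<close> lies there as well.\<close>

lemma exists_prime_ideal:
  "\<exists>P. prime_ideal_of z P \<and> l \<in> P \<and> of_nat p \<in> P"
proof -
  obtain M where M: "is_minpoly z M" using zeta_minpoly[OF n0] unfolding z_def by blast
  have "of_nat p * x \<noteq> 1" if "x \<in> R" for x
    by (rule Zadj_no_inverse_of_nat[OF M zn n0 that]) (use p1 in simp)
  then obtain P where P: "prime_ideal_of z P" "of_nat p \<in> P"
    using Zadj_prime_ideal_exists[of z "of_nat p"] Zadj_of_nat by blast
  note PD = prime_ideal_ofD[OF P(1)]
  have pow: "x \<in> P" if "x \<in> R" "x ^ k \<in> P" for x k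
    using that(2)
  proof (induction k)
    case 0
    thus ?case using PD(2) by simp
  next
    case (Suc k)
    hence "x * x ^ k \<in> P" by simp
    thus ?case using PD(5)[OF that(1) Zadj_power[OF that(1), of k]] Suc.IH by blast
  qed
  let ?q = "p ^ Suc r"
  have "Zcong z (of_nat p) ((1 + - (z ^ m)) ^ ?q) (1 ^ ?q + (- (z ^ m)) ^ ?q)"
    by (intro Zcong_frobenius p Zadj_intros)
  moreover have "Zcong z (of_nat p) (1 ^ ?q + (- (z ^ m)) ^ ?q) 0"
  proof -
    have 1: "(z ^ m) ^ ?q = 1" using zn by (simp add: n_def mult_ac flip: power_mult)
    have "Zcong z (of_nat p) ((z ^ m + - (z ^ m)) ^ ?q) ((z ^ m) ^ ?q + (- (z ^ m)) ^ ?q)"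
      by (intro Zcong_frobenius p Zadj_intros)
    moreover have "(z ^ m + - (z ^ m)) ^ ?q = 0" using p1 by simp
    ultimately show ?thesis using 1 Zcong_sym by (metis power_one)
  qed
  ultimately have "Zcong z (of_nat p) (l ^ ?q) 0" unfolding l_def using Zcong_trans by force
  then obtain c where "c \<in> R" "l ^ ?q = of_nat p * c" by (auto simp: Zcong_def)
  hence "l ^ ?q \<in> P" using PD(4)[of c "of_nat p"] P(2) by (simp add: mult.commute)
  hence "l \<in> P" using pow l_in by blast
  thus ?thesis using P by blast
qed

text \<open>Serves to bound the divisibility of \<open>x\<close> by powers of
  \<open>l\<close>.\<close>

lemma nonzero_divides_integer:
  assumes "x \<in> R" "x \<noteq> 0"
  obtains y k where "y \<in> R" "k > 0" "x * y = of_nat k"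
proof -
  obtain M where M: "is_minpoly z M" using zeta_minpoly[OF n0] unfolding z_def by blast
  have sf: "is_subfield (Qadj z)" by (rule Qadj_subfield[OF M])
  have "R \<subseteq> Qadj z"
  proof
    fix x assume "x \<in> R"
    thus "x \<in> Qadj z"
      by induction (use sf gen_in_Qadj in \<open>auto simp: is_subfield_def is_subring_def\<close>)
  qed
  hence "inverse x \<in> Qadj z" using sf assms by (auto simp: is_subfield_def)
  then obtain k where "k > 0" "of_nat k * inverse x \<in> R"
    using Qadj_imp_Zadj_multiple by blast
  thus ?thesis using that[of "of_nat k * inverse x" k] assms by simp
qed

text \<open>The localization of \<open>R\<close> at a prime ideal \<open>P\<close> containing
  \<open>p\<close> is a discrete valuation ring with uniformizer \<open>l\<close>; \<open>v\<close>
  is the exponent of \<open>l\<close>. The units are the quotients of elements of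
  \<open>U = R - P\<close>, and \<open>p = l^E g\<close> gives the ramification index.\<close>

lemma exists_valuation:
  "\<exists>v::complex \<Rightarrow> int. (\<forall>x\<in>Qadj z - {0}. \<forall>y\<in>Qadj z - {0}. v (x * y) = v x + v y) \<and>
     (\<forall>x\<in>Qadj z - {0}. \<forall>y\<in>Qadj z - {0}. x + y \<noteq> 0 \<longrightarrow> min (v x) (v y) \<le> v (x + y)) \<and>
     v (of_nat p) = int E \<and> (\<forall>k. \<not> p dvd k \<longrightarrow> v (of_nat k) = 0)"
proof -
  obtain P where P: "prime_ideal_of z P" "l \<in> P" "of_nat p \<in> P"
    using exists_prime_ideal by (elim exE conjE)
  note PD = prime_ideal_ofD[OF P(1)]
  obtain q where q: "q > 1" "\<And>x. x \<in> R \<Longrightarrow> Zcong z l (x ^ q) x"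
    using frobenius_fixes by (elim exE conjE) simp
  define U where "U = R - P"
  have U_R: "u \<in> R" if "u \<in> U" for u using that by (simp add: U_def)
  have U_mult: "u * w \<in> U" if "u \<in> U" "w \<in> U" for u w
    using that PD(5)[of u w] by (auto simp: U_def intro: Zadj_mult)
  have U_one: "1 \<in> U" using PD(2) by (auto simp: U_def intro: Zadj_one)
  have P_neg: "- x \<in> P" if "x \<in> P" for x
    using PD(4)[OF Zadj_neg[OF Zadj_one] that] by simp
  have zero_P: "0 \<in> P" using PD(4)[OF Zadj_zero P(2)] by simp
  have U_plus_P: "u + x \<in> U" if "u \<in> U" "x \<in> P" for u x
  proof -
    have "u + x \<in> R" using that PD(1) by (auto simp: U_def intro: Zadj_add)
    moreover have "u \<in> P" if "u + x \<in> P"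
      using PD(3)[OF that P_neg[OF \<open>x \<in> P\<close>]] by simp
    ultimately show ?thesis using that by (auto simp: U_def)
  qed
  have U_nat: "of_nat k \<in> U" if k: "\<not> p dvd k" for k
  proof -
    have "coprime (int p) (int k)" using p k by (simp add: prime_imp_coprime)
    then obtain a b where ab: "a * int p + b * int k = 1"
      using bezout_int[of "int p" "int k"] by auto
    have "of_nat k \<notin> P"
    proof
      assume kP: "of_nat k \<in> P"
      have "of_int a * of_nat p + of_int b * of_nat k \<in> P"
        by (intro PD(3) PD(4) Zadj_of_int P(3) kP)
      moreover have "of_int a * of_nat p + of_int b * of_nat k = (of_int (a * int p + b * int k) :: complex)"
        by simp
      ultimately show False using ab PD(2) by simp
    qed
    thus ?thesis by (simp add: U_def Zadj_of_nat)
  qed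
  \<comment> \<open>Modulo \<open>P\<close> each factor of \<open>g\<close> is congruent to its
    number of terms \<open>k\<close>, which is prime to \<open>p\<close>.\<close>
  have gU: "g \<in> U"
  proof -
    have sum_U: "(\<Sum>j<k. (z ^ m) ^ j) \<in> U" if k: "\<not> p dvd k" for k
    proof -
      have "(z ^ m) ^ j - 1 \<in> P" for j
      proof -
        have "(z ^ m) ^ j - 1 = - (\<Sum>i<j. (z ^ m) ^ i) * l"
          using one_diff_power_eq[of "z ^ m" j] by (simp add: l_def algebra_simps)
        thus ?thesis using PD(4)[OF _ P(2), of "- (\<Sum>i<j. (z ^ m) ^ i)"]
          by (simp add: Zadj_neg Zadj_sum Zadj_power Zadj_gen)
      qed
      hence "(\<Sum>j\<in>A. (z ^ m) ^ j - 1) \<in> P" for A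
        by (induction A rule: infinite_finite_induct) (auto intro: PD(3) zero_P)
      from U_plus_P[OF U_nat[OF k] this[of "{..<k}"]] show ?thesis by (simp add: sum_subtractf)
    qed
    have prod_U: "prod f A \<in> U" if "\<And>i. i \<in> A \<Longrightarrow> f i \<in> U" for f :: "nat \<Rightarrow> complex" and A
      using that by (induction A rule: infinite_finite_induct) (auto intro: U_one U_mult)
    have not_dvd: "\<not> p dvd k" if "k \<in> totatives (p ^ Suc r)" for k
    proof
      assume "p dvd k"
      moreover have "coprime k p" using that by (simp add: in_totatives_iff)
      ultimately have "p dvd 1" using coprime_common_divisor[of k p p] by simp
      thus False using p1 by simp
    qed
    show ?thesis unfolding g_def by (intro prod_U sum_U not_dvd)
  qed
  have U_power: "u ^ k \<in> U" if "u \<in> U" for u k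
    by (induction k) (auto intro: U_one U_mult that)

  define good where "good x \<longleftrightarrow> (\<exists>t. \<exists>u\<in>U. \<exists>w\<in>U. x * w = l ^ t * u)" for x
  have goodI: "good x" if "x * w = l ^ t * u" "u \<in> U" "w \<in> U" for x w t u
    unfolding good_def using that by blast
  \<comment> \<open>Until a representation is found, factors \<open>l\<close> can be split off
    indefinitely.\<close>
  have descend: "good x \<or> (\<exists>w\<in>U. \<exists>a\<in>R. x * w = l ^ t * a)"
    if x: "x \<in> R" for x t
  proof (induction t)
    case 0
    have "x * 1 = l ^ 0 * x" by simp
    thus ?case using x U_one by metis
  next
    case (Suc t)
    show ?case
    proof (cases "good x")
      case False
      with Suc.IH have "\<exists>w\<in>U. \<exists>a\<in>R. x * w = l ^ t * a" by simp
      then obtain w a where wa: "w \<in> U" "a \<in> R" "x * w = l ^ t * a" by (elim bexE)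
      have "a \<in> P"
      proof (rule ccontr)
        assume "a \<notin> P"
        hence "a \<in> U" using wa(2) by (simp add: U_def)
        from goodI[OF wa(3) this wa(1)] False show False by simp
      qed
      obtain b where b: "b \<in> R" "a ^ q = a + l * b" using q(2)[OF wa(2)] by (auto simp: Zcong_def)
      \<comment> \<open>\<open>a (1 - a^(q-1))\<close> is a multiple of \<open>l\<close>, and its
        second factor is in \<open>U\<close> because \<open>a\<close> is in \<open>P\<close>;
        \<open>a^(q-1)\<close> appears as \<open>a ^ q' * a\<close>.\<close>
      define q' where "q' = q - 2"
      have q': "q = Suc (Suc q')" using q(1) by (simp add: q'_def)
      have "- (a ^ q' * a) \<in> P" by (intro P_neg PD(4) Zadj_power wa \<open>a \<in> P\<close>)
      from U_plus_P[OF U_one this] have "w * (1 + - (a ^ q' * a)) \<in> U" using U_mult wa by blast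
      moreover have "x * (w * (1 + - (a ^ q' * a))) = l ^ t * (a - a ^ q)"
        using wa(3) by (simp add: q' algebra_simps)
      hence "x * (w * (1 + - (a ^ q' * a))) = l ^ Suc t * (- b)" using b by simp
      moreover have "- b \<in> R" using b Zadj_neg by blast
      ultimately show ?thesis by (intro disjI2 bexI)
    qed simp
  qed
  have R_rep: "good x" if x: "x \<in> R" "x \<noteq> 0" for x
  proof (rule ccontr)
    assume no: "\<not> ?thesis"
    obtain y k where y: "y \<in> R" "k > 0" "x * y = of_nat k" using nonzero_divides_integer x by blast
    obtain c k' where k: "k = p ^ c * k'" "\<not> p dvd k'"
      using y(2) p1 by (metis multiplicity_decompose' not_prime_unit p less_irrefl)
    \<comment> \<open>One factor \<open>l\<close> more than the \<open>E * c\<close> contained in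
      the integer \<open>k\<close>; the excess contradicts \<open>g\<close>, \<open>k'\<close> and
      \<open>w\<close> being in \<open>U\<close>.\<close>
    obtain w a where wa: "w \<in> U" "a \<in> R" "x * w = l ^ Suc (E * c) * a"
      using descend[OF x(1)] no by blast
    have "l ^ (E * c) * (g ^ c * of_nat k' * w) = of_nat k * w"
      by (simp add: k p_eq power_mult_distrib power_mult)
    also have "\<dots> = (x * w) * y" using y(3) by (simp add: mult_ac)
    also have "\<dots> = l ^ (E * c) * ((a * y) * l)" by (simp add: wa(3))
    finally have "g ^ c * of_nat k' * w = (a * y) * l" using l_nz by simp
    moreover have "(a * y) * l \<in> P" by (intro PD(4) P(2) Zadj_mult wa y)
    moreover have "g ^ c * of_nat k' * w \<in> U" using gU U_nat[OF k(2)] wa by (intro U_mult U_power)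
    ultimately show False by (simp add: U_def)
  qed

  define rep where "rep x t \<longleftrightarrow> (\<exists>u\<in>U. \<exists>w\<in>U. x * w = l powi t * u)" for x and t :: int
  have no_less: False if asm: "rep x t" "rep x t'" "t < t'" for x t t'
  proof -
    obtain u w u' w' where *: "u \<in> U" "w \<in> U" "x * w = l powi t * u"
      "u' \<in> U" "w' \<in> U" "x * w' = l powi t' * u'"
      using asm(1,2) unfolding rep_def by blast
    obtain s where s: "t' = t + int (Suc s)"
      using asm(3) zless_iff_Suc_zadd[of t t'] by blast
    have "l powi t * (u * w') = (x * w) * w'" by (simp add: *(3))
    also have "\<dots> = (x * w') * w" by (simp add: mult_ac)
    also have "\<dots> = l powi t * ((l ^ s * u' * w) * l)"
      unfolding *(6) s by (simp add: power_int_add l_nz power_int_of_nat del: of_nat_Suc)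
    finally have "u * w' = (l ^ s * u' * w) * l" using l_nz by simp
    moreover have "(l ^ s * u' * w) * l \<in> P"
      by (intro PD(4) P(2) Zadj_mult Zadj_power l_in U_R *)
    moreover have "u * w' \<in> U" by (intro U_mult *)
    ultimately show False by (simp add: U_def)
  qed
  have rep_unique: "t = t'" if "rep x t" "rep x t'" for x t t'
    using no_less that by (metis linorder_neq_iff)
  have rep_R: "\<exists>t\<ge>0. rep x t" if x: "x \<in> R" "x \<noteq> 0" for x
  proof -
    obtain t u w where "u \<in> U" "w \<in> U" "x * w = l ^ t * u" using R_rep[OF x] unfolding good_def by blast
    hence "rep x (int t)" unfolding rep_def by (auto simp: power_int_of_nat)
    thus ?thesis by (intro exI[of _ "int t"]) simp
  qed
  have rep_mult: "rep (x * y) (t + t')" if asm: "rep x t" "rep y t'" for x y t t'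
  proof -
    obtain u w u' w' where *: "u \<in> U" "w \<in> U" "x * w = l powi t * u"
      "u' \<in> U" "w' \<in> U" "y * w' = l powi t' * u'"
      using asm unfolding rep_def by blast
    have "(x * y) * (w * w') = (x * w) * (y * w')" by (simp add: mult_ac)
    also have "\<dots> = l powi (t + t') * (u * u')" unfolding *(3,6) by (simp add: power_int_add l_nz)
    finally show ?thesis unfolding rep_def using U_mult * by blast
  qed
  have rep_Q: "\<exists>t. rep x t" if x: "x \<in> Qadj z" "x \<noteq> 0" for x
  proof -
    obtain k where k: "k > 0" "of_nat k * x \<in> R" using Qadj_imp_Zadj_multiple[OF x(1)] by blast
    obtain t where "rep (of_nat k * x) t" using rep_R[OF k(2)] k(1) x by auto
    then obtain u w where uw: "u \<in> U" "w \<in> U" "of_nat k * x * w = l powi t * u" unfolding rep_def by blast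
    obtain t' where "rep (of_nat k) t'" using rep_R[OF Zadj_of_nat, of k] k(1) by auto
    then obtain u' w' where uw': "u' \<in> U" "w' \<in> U" "of_nat k * w' = l powi t' * u'" unfolding rep_def by blast
    have "l powi t' * (x * (u' * w)) = (l powi t' * u') * x * w" by (simp add: mult_ac)
    also have "\<dots> = (of_nat k * x * w) * w'" unfolding uw'(3)[symmetric] by (simp add: mult_ac)
    also have "\<dots> = l powi (t' + (t - t')) * (u * w')" unfolding uw(3) by simp
    also have "\<dots> = l powi t' * (l powi (t - t') * (u * w'))"
      unfolding power_int_add[OF disjI1[OF l_nz]] by simp
    finally have "x * (u' * w) = l powi (t - t') * (u * w')" using l_nz by simp
    thus ?thesis unfolding rep_def using U_mult uw uw' by blast
  qed
  \<comment> \<open>No value is fixed at 0, so the laws speak of nonzero elements only.\<close>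
  define v where "v x = (THE t. rep x t)" for x
  have v_eq: "v x = t" if "rep x t" for x t
    unfolding v_def using that rep_unique by blast
  have v_rep: "rep x (v x)" if "x \<in> Qadj z" "x \<noteq> 0" for x
    using rep_Q[OF that] v_eq by auto
  obtain M where M: "is_minpoly z M" using zeta_minpoly[OF n0] unfolding z_def by blast
  have add_cl: "x + y \<in> Qadj z" if "x \<in> Qadj z" "y \<in> Qadj z" for x y
    using Qadj_subfield[OF M] that by (auto simp: is_subfield_def is_subring_def)
  have min_le: "t \<le> v (x + y)" if asm: "rep x t" "rep y t'" "t \<le> t'" "x + y \<noteq> 0" for x y t t'
  proof -
    obtain u w u' w' where *: "u \<in> U" "w \<in> U" "x * w = l powi t * u"
      "u' \<in> U" "w' \<in> U" "y * w' = l powi t' * u'"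
      using asm(1,2) unfolding rep_def by blast
    obtain s where s: "t' = t + int s" using asm(3) zle_iff_zadd[of t t'] by blast
    \<comment> \<open>Once \<open>l powi t\<close> is taken out, the remaining factor lies in
      \<open>R\<close>, so its exponent is nonnegative.\<close>
    define a where "a = u * w' + l ^ s * u' * w"
    have "(x + y) * (w * w') = (x * w) * w' + (y * w') * w" by (simp add: algebra_simps)
    also have "\<dots> = l powi t * a"
      unfolding *(3,6) s a_def by (simp add: power_int_add l_nz power_int_of_nat algebra_simps)
    finally have eq: "(x + y) * (w * w') = l powi t * a" .
    have "a \<in> R" unfolding a_def by (intro Zadj_add Zadj_mult Zadj_power l_in U_R *)
    moreover have "w * w' \<noteq> 0" using U_mult[OF *(2,5)] zero_P by (auto simp: U_def)
    hence "a \<noteq> 0" using eq asm(4) by auto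
    ultimately obtain e where e: "e \<ge> 0" "rep a e" using rep_R by blast
    then obtain u'' w'' where **: "u'' \<in> U" "w'' \<in> U" "a * w'' = l powi e * u''"
      unfolding rep_def by blast
    have "(x + y) * (w * w' * w'') = l powi t * (a * w'')" using eq by (simp add: mult_ac)
    also have "\<dots> = l powi (t + e) * u''" unfolding **(3) by (simp add: power_int_add l_nz)
    finally have "rep (x + y) (t + e)" unfolding rep_def using U_mult * ** by blast
    thus ?thesis using v_eq e by simp
  qed
  have "v (x * y) = v x + v y" if "x \<in> Qadj z - {0}" "y \<in> Qadj z - {0}" for x y
    using rep_mult[OF v_rep v_rep, of x y] v_eq that by simp
  moreover have "min (v x) (v y) \<le> v (x + y)"
    if "x \<in> Qadj z - {0}" "y \<in> Qadj z - {0}" "x + y \<noteq> 0" for x y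
  proof (cases "v x \<le> v y")
    case True
    thus ?thesis using min_le[OF v_rep v_rep, of x y] that by simp
  next
    case False
    thus ?thesis using min_le[OF v_rep v_rep, of y x] that by (simp add: add.commute)
  qed
  moreover have "v (of_nat p) = int E"
  proof (rule v_eq)
    have "of_nat p * 1 = l powi int E * g" using p_eq by (simp add: power_int_of_nat)
    thus "rep (of_nat p) (int E)" unfolding rep_def using gU U_one by blast
  qed
  moreover have "v (of_nat k) = 0" if "\<not> p dvd k" for k
  proof (rule v_eq)
    have "of_nat k * 1 = l powi 0 * of_nat k" by simp
    thus "rep (of_nat k) 0" unfolding rep_def using U_nat[OF that] U_one by blast
  qed
  ultimately show ?thesis by (intro exI[of _ v]) simp
qed

end

section \<open>Discrete valuations on subfields\<close>

locale valued_field =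
  fixes K :: "complex set" and v :: "complex \<Rightarrow> int"
  assumes field: "is_subfield K"
    and v_mult: "x \<in> K \<Longrightarrow> y \<in> K \<Longrightarrow> x \<noteq> 0 \<Longrightarrow> y \<noteq> 0 \<Longrightarrow> v (x * y) = v x + v y"
    and v_add: "x \<in> K \<Longrightarrow> y \<in> K \<Longrightarrow> x \<noteq> 0 \<Longrightarrow> y \<noteq> 0 \<Longrightarrow> x + y \<noteq> 0 \<Longrightarrow> min (v x) (v y) \<le> v (x + y)"
begin

lemma K_closed [intro]:
  "0 \<in> K" "1 \<in> K" "x \<in> K \<Longrightarrow> y \<in> K \<Longrightarrow> x + y \<in> K" "x \<in> K \<Longrightarrow> y \<in> K \<Longrightarrow> x * y \<in> K"
  "x \<in> K \<Longrightarrow> - x \<in> K" "x \<in> K \<Longrightarrow> inverse x \<in> K"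
  using field by (cases "x = 0"; auto simp: is_subfield_def is_subring_def)+

lemma K_power [intro]: "x \<in> K \<Longrightarrow> x ^ k \<in> K"
  by (induction k) auto

lemma K_of_nat [intro]: "of_nat k \<in> K"
  by (induction k) auto

lemma K_of_rat [intro]: "of_rat q \<in> K"
proof (cases q)
  case (Fract a b)
  have int: "of_int k \<in> K" for k :: int
    by (cases k) (auto simp del: of_nat_Suc)
  have "of_rat q = of_int a * inverse (of_int b :: complex)"
    using Fract by (simp add: of_rat_rat field_simps)
  thus ?thesis using int K_closed by metis
qed

lemma v_one: "v 1 = 0"
  using v_mult[of 1 1] by auto

lemma v_minus: "x \<in> K \<Longrightarrow> v (- x) = v x"
proof (cases "x = 0")
  case False
  assume x: "x \<in> K"
  have "v ((- 1) * (- 1)) = v (- 1) + v (- 1)" by (rule v_mult) auto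
  hence "v (- 1) = 0" using v_one by simp
  moreover have "v ((- 1) * x) = v (- 1) + v x" by (rule v_mult) (use x False in auto)
  ultimately show ?thesis by simp
qed simp

lemma v_power: "x \<in> K \<Longrightarrow> x \<noteq> 0 \<Longrightarrow> v (x ^ k) = int k * v x"
proof (induction k)
  case (Suc k)
  have "v (x * x ^ k) = v x + v (x ^ k)" by (rule v_mult) (use Suc in auto)
  thus ?case using Suc by (simp add: algebra_simps)
qed (simp add: v_one)

lemma v_inverse: "x \<in> K \<Longrightarrow> x \<noteq> 0 \<Longrightarrow> v (inverse x) = - v x"
  using v_mult[of x "inverse x"] v_one K_closed(6)[of x] by auto

lemma v_powi: "x \<in> K \<Longrightarrow> x \<noteq> 0 \<Longrightarrow> v (x powi k) = k * v x"
  by (cases "k \<ge> 0") (auto simp: power_int_def v_power v_inverse power_inverse K_power)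

text \<open>\<open>v 0\<close> is unspecified, so vanishing sums form a separate
  alternative.\<close>

lemma v_sum_gt:
  assumes "finite A" "\<And>i. i \<in> A \<Longrightarrow> f i \<in> K" "\<And>i. i \<in> A \<Longrightarrow> f i = 0 \<or> v (f i) > c"
  shows "sum f A \<in> K \<and> (sum f A = 0 \<or> v (sum f A) > c)"
  using assms
proof (induction A rule: finite_induct)
  case (insert i A)
  have IH: "sum f A \<in> K" "sum f A = 0 \<or> v (sum f A) > c" using insert by auto
  have i: "f i \<in> K" "f i = 0 \<or> v (f i) > c" using insert by auto
  have "f i + sum f A = 0 \<or> v (f i + sum f A) > c"
  proof (cases "f i = 0 \<or> sum f A = 0 \<or> f i + sum f A = 0")
    case False
    hence "min (v (f i)) (v (sum f A)) \<le> v (f i + sum f A)" using v_add i IH by blast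
    thus ?thesis using False i IH by auto
  qed (use i IH in auto)
  thus ?case using IH i insert by auto
qed auto

text \<open>Ultrametric principle: the other terms add up to 0 or to something of larger valuation,
  so they cannot cancel \<open>f i0\<close>.\<close>

lemma sum_nonzero_if_unique_min:
  assumes "finite A" "\<And>i. i \<in> A \<Longrightarrow> f i \<in> K" "i0 \<in> A" "f i0 \<noteq> 0"
    and "\<And>i. i \<in> A \<Longrightarrow> i \<noteq> i0 \<Longrightarrow> f i = 0 \<or> v (f i) > v (f i0)"
  shows "sum f A \<noteq> 0"
proof
  assume 0: "sum f A = 0"
  have "sum f A = f i0 + sum f (A - {i0})" using assms by (simp add: sum.remove)
  hence eq: "sum f (A - {i0}) = - f i0" using 0 by (simp add: eq_neg_iff_add_eq_0 add.commute)
  have "sum f (A - {i0}) = 0 \<or> v (sum f (A - {i0})) > v (f i0)"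
    using v_sum_gt[of "A - {i0}" f "v (f i0)"] assms by auto
  thus False using eq assms v_minus by auto
qed

end

text \<open>A cyclotomic field of order \<open>N\<close> containing \<open>x\<close> is enlarged by
  the factor \<open>p\<close>. With \<open>p ^ r\<close> the exact power of \<open>p\<close> in
  \<open>N\<close>, the ramification index is then as claimed even for \<open>r = 0\<close>. Note
  that \<open>r\<close> depends on \<open>x\<close>.\<close>

lemma Qab_valuation:
  assumes p: "prime p" and x: "x \<in> Qab"
  shows "\<exists>K v r. valued_field K v \<and> x \<in> K \<and> v (of_nat p) = int (p ^ r * (p - 1)) \<and>
    (\<forall>k. \<not> p dvd k \<longrightarrow> v (of_nat k) = 0)"
proof -
  obtain N where N1: "N \<ge> 1" "x \<in> cyclotomic_field N" using x by (auto simp: Qab_def)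
  have p0: "p > 0" using p prime_gt_0_nat by blast
  have np: "N * p > 0" using N1 p0 by simp
  obtain r m where Nm: "N = p ^ r * m" "\<not> p dvd m"
    using multiplicity_decompose'[of N p] N1 p not_prime_unit by (metis not_one_le_zero)
  interpret cyclotomic_prime p r m by standard (use p Nm in auto)
  have z: "z = zeta (N * p)" unfolding z_def n_def using Nm(1) by (simp add: mult_ac)
  have "x \<in> cyclotomic_field (N * p)" using cyclotomic_field_mono[of N p] N1 p0 by auto
  hence xK: "x \<in> Qadj z" using cyclotomic_field_subset_Qadj[OF np] by (auto simp: z)
  obtain M where "is_minpoly z M" using zeta_minpoly[OF np] unfolding z by blast
  hence sf: "is_subfield (Qadj z)" by (rule Qadj_subfield)
  obtain v :: "complex \<Rightarrow> int" where v: "\<forall>x\<in>Qadj z - {0}. \<forall>y\<in>Qadj z - {0}. v (x * y) = v x + v y"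
     "\<forall>x\<in>Qadj z - {0}. \<forall>y\<in>Qadj z - {0}. x + y \<noteq> 0 \<longrightarrow> min (v x) (v y) \<le> v (x + y)"
     "v (of_nat p) = int E" "\<forall>k. \<not> p dvd k \<longrightarrow> v (of_nat k) = 0"
    using exists_valuation by (elim exE conjE)
  have "valued_field (Qadj z) v"
    by standard (use sf v(1,2) in auto)
  thus ?thesis using xK v(3,4) unfolding E_def by (intro exI[of _ "Qadj z"] exI[of _ v] exI[of _ r]) simp
qed

text \<open>The \<open>p\<close>-adic valuation as a relation. The part prime to \<open>p\<close> is
  a quotient of naturals with the sign split off, because \<open>v\<close> is given on
  naturals.\<close>

definition padic_exponent :: "nat \<Rightarrow> rat \<Rightarrow> int \<Rightarrow> bool" where
  "padic_exponent p q e \<longleftrightarrow> (\<exists>a b::nat. \<not> p dvd a \<and> \<not> p dvd b \<and>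
     (q = of_nat p powi e * of_nat a / of_nat b \<or> q = - (of_nat p powi e * of_nat a / of_nat b)))"

lemma padic_exponent_exists:
  assumes p: "prime p" and q: "q \<noteq> 0"
  shows "\<exists>e. padic_exponent p q e"
proof -
  obtain u w where uw: "q = Rat.Fract u w" "w > 0" by (cases q)
  have u0: "u \<noteq> 0" using uw q by (auto simp: rat_number_collapse)
  have dec: "\<exists>i a. k = p ^ i * a \<and> \<not> p dvd a" if "k > 0" for k
    using multiplicity_decompose'[of k p] that p not_prime_unit by (metis less_irrefl)
  obtain i a where a: "nat \<bar>u\<bar> = p ^ i * a" "\<not> p dvd a" using dec[of "nat \<bar>u\<bar>"] u0 by auto
  obtain j b where b: "nat w = p ^ j * b" "\<not> p dvd b" using dec[of "nat w"] uw by auto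
  have p0: "p > 0" using p prime_gt_0_nat by blast
  have w: "of_int w = (of_nat (p ^ j * b) :: rat)" using b uw(2)
    by (metis less_le nat_0_le of_int_of_nat_eq)
  have u: "of_int \<bar>u\<bar> = (of_nat (p ^ i * a) :: rat)" using a(1)
    by (metis abs_ge_zero nat_0_le of_int_of_nat_eq)
  have "\<bar>q\<bar> = of_int \<bar>u\<bar> / of_int w" using uw by (simp add: Fract_of_int_quotient)
  also have "\<dots> = of_nat p powi (int i - int j) * of_nat a / of_nat b"
    unfolding w u using p0 by (simp add: power_int_diff power_int_of_nat)
  finally have "\<bar>q\<bar> = of_nat p powi (int i - int j) * of_nat a / of_nat b" .
  hence "q = of_nat p powi (int i - int j) * of_nat a / of_nat b \<or>
    q = - (of_nat p powi (int i - int j) * of_nat a / of_nat b)" by linarith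
  thus ?thesis using a b unfolding padic_exponent_def by blast
qed

lemma (in valued_field) v_padic_exponent:
  assumes p: "prime p" and vp: "v (of_nat p) = E" and v0: "\<And>k. \<not> p dvd k \<Longrightarrow> v (of_nat k) = 0"
    and q: "padic_exponent p q e"
  shows "q \<noteq> 0" "v (of_rat q) = E * e"
proof -
  obtain a b :: nat where ab: "\<not> p dvd a" "\<not> p dvd b"
     "q = of_nat p powi e * of_nat a / of_nat b \<or> q = - (of_nat p powi e * of_nat a / of_nat b)"
    using q by (auto simp: padic_exponent_def)
  have p0: "p > 0" using p prime_gt_0_nat by blast
  have nz: "a \<noteq> 0" "b \<noteq> 0" using ab by (metis dvd_0_right)+
  show "q \<noteq> 0" using ab(3) nz p0 by auto
  define y :: complex where "y = of_nat p powi e * of_nat a * inverse (of_nat b)"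
  have pK: "of_nat p powi e \<in> K"
    by (cases "e \<ge> 0") (auto simp: power_int_def)
  have y: "y \<in> K" unfolding y_def using pK by auto
  have "v (of_nat p powi e * of_nat a) = v (of_nat p powi e) + v (of_nat a)"
    by (rule v_mult) (use pK nz p0 in auto)
  moreover have "v y = v (of_nat p powi e * of_nat a) + v (inverse (of_nat b))"
    unfolding y_def by (rule v_mult) (use pK nz p0 in auto)
  moreover have "v (of_nat p powi e) = e * E" using v_powi[of "of_nat p" e] vp p0 by auto
  moreover have "v (inverse (of_nat b)) = 0" using v_inverse[of "of_nat b"] v0 ab nz by auto
  ultimately have "v y = E * e" using v0 ab by simp
  moreover have "of_rat (of_nat p powi e) = (of_nat p powi e :: complex)"
    by (cases "e \<ge> 0") (auto simp: power_int_def of_rat_power of_rat_inverse)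
  hence "of_rat (of_nat p powi e * of_nat a / of_nat b) = y"
    by (simp add: y_def of_rat_mult of_rat_divide divide_inverse of_rat_inverse)
  hence "of_rat q = y \<or> of_rat q = - y" using ab(3) by (auto simp: of_rat_minus)
  ultimately show "v (of_rat q) = E * e" using v_minus y by auto
qed

section \<open>Choice of the prime and the exponent\<close>

text \<open>Sorts edge lengths by the available obstruction. Without an odd prime factor,
  \<open>i\<close> is a power of 2 and at least 4. Divisibility by 8 is recorded since it leaves
  more room for the exponent than 4 does.\<close>

lemma odd_prime_or_four_dvd:
  fixes i :: nat
  assumes "i \<ge> 3"
  shows "(\<exists>q. prime q \<and> odd q \<and> q dvd i) \<or> 4 dvd i \<and> (i = 4 \<or> 8 dvd i)"
proof (cases "\<exists>q. prime q \<and> odd q \<and> q dvd i")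
  case False
  obtain k m where km: "i = 2 ^ k * m" "\<not> 2 dvd m"
    using multiplicity_decompose'[of i 2] assms 
    by (metis not_numeral_le_zero not_prime_unit two_is_prime_nat)
  have "m = 1"
  proof (rule ccontr)
    assume "m \<noteq> 1"
    then obtain q where "prime q" "q dvd m" using prime_factor_nat by blast
    moreover from this have "odd q" using km(2) dvd_trans by blast
    ultimately show False using False km(1) by auto
  qed
  hence k: "i = 2 ^ k" using km by simp
  have "\<not> (k = 0 \<or> k = 1)"
  proof
    assume "k = 0 \<or> k = 1"
    hence "i \<le> 2" using k by (elim disjE) simp_all
    thus False using assms by simp
  qed
  then obtain j where j: "k = j + 2" using that[of "k - 2"] by auto
  show ?thesis using k j by (cases j) auto
qed simp

lemma dvd_shift_at_most_once:
  fixes q e k j :: int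
  assumes "q dvd e + k" "q dvd e + (k + j)"
  shows "q dvd j"
  using dvd_diff[OF assms(2,1)] by simp

lemma not_dvd_prime_power_mult:
  fixes q p :: nat and x :: int
  assumes "prime q" "prime p" "q \<noteq> p" "\<not> q dvd p - 1" "\<not> int q dvd x"
  shows "\<not> int q dvd int (p ^ r * (p - 1)) * x"
proof
  assume "int q dvd int (p ^ r * (p - 1)) * x"
  hence "int q dvd int (p ^ r * (p - 1)) \<or> int q dvd x"
    using assms(1) prime_dvd_multD[of "int q"] by simp
  hence "int q dvd int (p ^ r * (p - 1))" using assms(5) by blast
  hence "q dvd p ^ r * (p - 1)" by (simp only: of_nat_dvd_iff)
  hence "q dvd p ^ r" using assms(1,4) by (simp add: prime_dvd_mult_iff)
  hence "q dvd p" using assms(1) prime_dvd_power by blast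
  thus False using assms primes_dvd_imp_eq by blast
qed

lemma not_dvd_odd_double:
  fixes x y :: int
  assumes "odd y"
  shows "odd x \<Longrightarrow> \<not> 4 dvd (y * 2) * x" "\<not> 4 dvd x \<Longrightarrow> \<not> 8 dvd (y * 2) * x"
proof -
  have "coprime (2 ^ 2) y" "coprime (2 ^ 3) y" using assms 
    by (simp_all only: coprime_power_left_iff coprime_left_2_iff_odd simp_thms)
  moreover have "(2::int) ^ 2 = 4" "(2::int) ^ 3 = 8" by simp_all
  ultimately have "coprime 4 y" "coprime 8 y" by (simp_all only:)
  hence "4 dvd y * (2 * x) \<longleftrightarrow> 4 dvd 2 * x" "8 dvd y * (2 * x) \<longleftrightarrow> 8 dvd 2 * x"
    using coprime_dvd_mult_right_iff[of 4 y "2 * x"] coprime_dvd_mult_right_iff[of 8 y "2 * x"]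
    by blast+
  moreover have "4 dvd 2 * x \<longleftrightarrow> 2 dvd x" "8 dvd 2 * x \<longleftrightarrow> 4 dvd x" by presburger+
  ultimately show "odd x \<Longrightarrow> \<not> 4 dvd (y * 2) * x" "\<not> 4 dvd x \<Longrightarrow> \<not> 8 dvd (y * 2) * x"
    by (simp_all only: mult.assoc simp_thms)
qed

text \<open>\<open>x / i\<close> is, up to sign, the slope of a Newton polygon edge of length
  \<open>i\<close> when \<open>p\<close> has valuation 1; no ramification index makes it integral.
  All \<open>r\<close> are included because the field containing a root is unknown when
  \<open>p\<close> and the exponent are chosen.\<close>

definition ramification_avoids :: "nat \<Rightarrow> nat \<Rightarrow> int \<Rightarrow> bool" where
  "ramification_avoids p i x \<longleftrightarrow> (\<forall>r. \<not> int i dvd int (p ^ r * (p - 1)) * x)"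

lemma ramification_avoids_dvd:
  "ramification_avoids p q x \<Longrightarrow> q dvd i \<Longrightarrow> ramification_avoids p i x"
  unfolding ramification_avoids_def by (metis dvd_trans of_nat_dvd_iff)

lemma ramification_avoids_prime:
  assumes "prime q" "prime p" "q \<noteq> p" "\<not> q dvd p - 1" "\<not> int q dvd x"
  shows "ramification_avoids p q x"
  unfolding ramification_avoids_def using not_dvd_prime_power_mult[OF assms] by blast

lemma ramification_avoids_two_power:
  assumes "p = 3 \<or> p = 11"
  shows "odd x \<Longrightarrow> ramification_avoids p 4 x" "\<not> 4 dvd x \<Longrightarrow> ramification_avoids p 8 x"
proof -
  have "\<exists>y. odd y \<and> int (p ^ r * (p - 1)) = y * 2" for r
    using assms
  proof
    assume "p = 3" thus ?thesis by (intro exI[of _ "3 ^ r"]) auto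
  next
    assume "p = 11" thus ?thesis by (intro exI[of _ "11 ^ r * 5"]) auto
  qed
  thus "odd x \<Longrightarrow> ramification_avoids p 4 x" "\<not> 4 dvd x \<Longrightarrow> ramification_avoids p 8 x"
    unfolding ramification_avoids_def using not_dvd_odd_double by (metis of_nat_numeral)+
qed

lemma odd_prime_ge_3: "prime q \<Longrightarrow> odd q \<Longrightarrow> q \<ge> (3::nat)"
  using prime_ge_2_nat[of q] by (cases "q = 2") auto

lemma int_not_dvd_small: "q \<ge> (3::nat) \<Longrightarrow> \<not> int q dvd 1" "q \<ge> (3::nat) \<Longrightarrow> \<not> int q dvd 2"
  using zdvd_imp_le[of "int q" 1] zdvd_imp_le[of "int q" 2] by auto

text \<open>Among \<open>B\<close>, \<open>B + 1\<close>, \<open>B + 2\<close>, each modulus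
  excludes at most one.\<close>

lemma choose_avoid_odd:
  assumes "q \<ge> (3::nat)" "q' \<ge> (3::nat)"
  shows "\<exists>k\<ge>B. \<not> int q dvd e + k \<and> \<not> int q' dvd f + k"
proof (rule ccontr)
  assume "\<not> ?thesis"
  hence *: "int q dvd e + k \<or> int q' dvd f + k" if "k \<ge> B" for k using that by blast
  have "\<not> (int s dvd x + a \<and> int s dvd x + b)" if "s \<ge> 3" "b - a = 1 \<or> b - a = 2" for s x a b
  proof
    assume "int s dvd x + a \<and> int s dvd x + b"
    hence "int s dvd (x + b) - (x + a)" by (intro dvd_diff) auto
    moreover have "(x + b) - (x + a) = b - a" by simp
    ultimately show False using that int_not_dvd_small[of s] by (metis (no_types))
  qed
  from this[OF assms(1), of "B + 1" B e] this[OF assms(1), of "B + 2" B e]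
    this[OF assms(1), of "B + 2" "B + 1" e] this[OF assms(2), of "B + 1" B f]
    this[OF assms(2), of "B + 2" B f] this[OF assms(2), of "B + 2" "B + 1" f]
    *[of B] *[of "B + 1"] *[of "B + 2"]
  show False by auto
qed

text \<open>Parity is settled first; then \<open>k\<close> and \<open>k + 2\<close> cannot both be
  bad, as \<open>q\<close> does not divide 2.\<close>

lemma choose_avoid_even:
  assumes "q = 4 \<or> (q \<ge> (3::nat) \<and> odd q)"
  shows "\<exists>k\<ge>B. odd (e + k) \<and> \<not> int q dvd f + k"
proof -
  obtain k where k: "k \<ge> B" "odd (e + k)"
  proof (cases "odd (e + B)")
    case False
    thus ?thesis using that[of "B + 1"] by auto
  qed (use that[of B] in auto)
  have "\<not> int q dvd 2" using assms int_not_dvd_small[of q] by auto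
  hence "\<not> int q dvd f + k \<or> \<not> int q dvd f + (k + 2)" using dvd_shift_at_most_once by blast
  thus ?thesis
  proof
    assume "\<not> int q dvd f + (k + 2)"
    thus ?thesis using k by (intro exI[of _ "k + 2"]) auto
  qed (use k in blast)
qed

text \<open>The length \<open>i\<close> is obstructed by 4, so \<open>p - 1\<close> should be twice
  an odd number. If \<open>j\<close> has no odd prime factor either, oddness is asked at one length,
  and at the other, divisible by 8, only that 4 does not divide.\<close>

lemma choose_prime_aux:
  assumes j: "j \<ge> 3" and i: "4 dvd i" "i = 4 \<or> 8 dvd i" and ij: "\<not> (i = 4 \<and> j = 4)"
  shows "\<exists>p. prime p \<and> (\<forall>e f B. \<exists>k\<ge>B. ramification_avoids p i (e + k) \<and> ramification_avoids p j (f + k))"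
proof (cases "\<exists>q. prime q \<and> odd q \<and> q dvd j")
  case True
  then obtain q where q: "prime q" "odd q" "q dvd j" by blast
  have q3: "q \<ge> 3" using odd_prime_ge_3 q by blast
  \<comment> \<open>Both values are 3 modulo 4. For \<open>q \<ge> 5\<close> the prime 3 works, as
    \<open>q\<close> does not divide 2; for \<open>q = 3\<close> it is replaced by 11, as 3 does not
    divide 10.\<close>
  define p :: nat where "p = (if q = 3 then 11 else 3)"
  have p: "prime p" "p = 3 \<or> p = 11" by (auto simp: p_def)
  have qp: "q \<noteq> p" "\<not> q dvd p - 1"
  proof -
    show "q \<noteq> p" by (auto simp: p_def)
    show "\<not> q dvd p - 1"
    proof (cases "q = 3")
      case False
      thus ?thesis using q3 by (auto simp: p_def dest: dvd_imp_le)
    qed (auto simp: p_def)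
  qed
  have "\<exists>k\<ge>B. ramification_avoids p i (e + k) \<and> ramification_avoids p j (f + k)" for e f B
  proof -
    obtain k where k: "k \<ge> B" "odd (e + k)" "\<not> int q dvd f + k"
      using choose_avoid_even[of q B e f] q q3 by blast
    have "ramification_avoids p i (e + k)"
      using ramification_avoids_dvd[OF ramification_avoids_two_power(1)[OF p(2) k(2)] i(1)] .
    moreover have "ramification_avoids p j (f + k)"
      using ramification_avoids_dvd[OF ramification_avoids_prime[OF q(1) p(1) qp k(3)] q(3)] .
    ultimately show ?thesis using k(1) by blast
  qed
  thus ?thesis using p by blast
next
  case False
  hence j': "4 dvd j" "j = 4 \<or> 8 dvd j" using odd_prime_or_four_dvd[OF j] by auto
  have p: "prime (3::nat)" by simp
  have "\<exists>k\<ge>B. ramification_avoids 3 i (e + k) \<and> ramification_avoids 3 j (f + k)" for e f B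
  proof (cases "8 dvd i")
    case True
    obtain k where k: "k \<ge> B" "odd (f + k)" "\<not> int 4 dvd e + k"
      using choose_avoid_even[of 4 B f e] by blast
    thus ?thesis
      using ramification_avoids_dvd[OF ramification_avoids_two_power(1)[of 3] j'(1)]
        ramification_avoids_dvd[OF ramification_avoids_two_power(2)[of 3] True] by auto
  next
    case False
    hence "8 dvd j" using i ij j' by auto
    obtain k where k: "k \<ge> B" "odd (e + k)" "\<not> int 4 dvd f + k"
      using choose_avoid_even[of 4 B e f] by blast
    thus ?thesis
      using ramification_avoids_dvd[OF ramification_avoids_two_power(1)[of 3] i(1)]
        ramification_avoids_dvd[OF ramification_avoids_two_power(2)[of 3] \<open>8 dvd j\<close>] by auto
  qed
  thus ?thesis using p by blast
qed

text \<open>If both lengths have odd prime factors, \<open>p = 2\<close> serves, its ramification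
  indices being powers of 2. Otherwise \<open>choose_prime_aux\<close> applies, up to exchanging the
  lengths.\<close>

lemma choose_prime:
  assumes "i \<ge> 3" "j \<ge> 3" "\<not> (i = 4 \<and> j = 4)"
  shows "\<exists>p. prime p \<and> (\<forall>e f B. \<exists>k\<ge>B. ramification_avoids p i (e + k) \<and> ramification_avoids p j (f + k))"
proof -
  consider "4 dvd i" "i = 4 \<or> 8 dvd i" | "4 dvd j" "j = 4 \<or> 8 dvd j"
    | q q' where "prime q" "odd q" "q dvd i" "prime q'" "odd q'" "q' dvd j"
    using odd_prime_or_four_dvd[OF assms(1)] odd_prime_or_four_dvd[OF assms(2)] by blast
  thus ?thesis
  proof cases
    case 1
    thus ?thesis using choose_prime_aux assms by blast
  next
    case 2
    then obtain p where "prime p" "\<forall>e f B. \<exists>k\<ge>B. ramification_avoids p j (e + k) \<and> ramification_avoids p i (f + k)"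
      using choose_prime_aux[of i j] assms by blast
    thus ?thesis by blast
  next
    case (3 q q')
    have q3: "q \<ge> 3" "q' \<ge> 3" using 3 odd_prime_ge_3 by blast+
    have ne: "q \<noteq> 2" "q' \<noteq> 2" "\<not> q dvd 2 - 1" "\<not> q' dvd 2 - 1" using q3 by auto
    have "\<exists>k\<ge>B. ramification_avoids 2 i (e + k) \<and> ramification_avoids 2 j (f + k)" for e f B
    proof -
      obtain k where "k \<ge> B" "\<not> int q dvd e + k" "\<not> int q' dvd f + k"
        using choose_avoid_odd q3 by blast
      thus ?thesis
        using ramification_avoids_dvd[OF ramification_avoids_prime[of q 2] 3(3)]
          ramification_avoids_dvd[OF ramification_avoids_prime[of q' 2] 3(6)] 3 ne two_is_prime_nat
        by blast
    qed
    thus ?thesis using two_is_prime_nat by blast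
  qed
qed

section \<open>Newton polygons\<close>

text \<open>\<open>k\<close> is so large that a slope beyond the edge outweighs, in a single step,
  the spread \<open>2 * B * E\<close> of the other valuations.\<close>

lemma steep_slope:
  fixes r E B k :: int
  assumes "0 < i" "i \<le> d" "E > 0" "B \<ge> 0" "k \<ge> B + 2 * B * int d" "int i * r > E * (k - B)"
  shows "r > 2 * B * E"
proof -
  have "int i * (2 * B * E) \<le> int d * (2 * B * E)" using assms by (intro mult_right_mono) auto
  also have "\<dots> = E * (2 * B * int d)" by simp
  also have "\<dots> \<le> E * (k - B)" using assms by (intro mult_left_mono) auto
  also have "\<dots> < int i * r" using assms by simp
  finally show ?thesis using assms(1) by (simp add: mult_less_cancel_left)
qed

text \<open>Keeps terms strictly inside an edge from reaching the minimum. For positive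
  \<open>r\<close>, as \<open>g \<le> i - 1\<close>, it comes down to
  \<open>(i - 1) (k + B) < i (k - B)\<close>, that is, \<open>2 B i < k + B\<close>.\<close>

lemma shallow_slope:
  fixes r E B k :: int
  assumes "0 < g" "g < i" "i \<le> d" "E > 0" "B \<ge> 0" "k > B + 2 * B * int d" "int i * r < E * (k + B)"
  shows "int g * r < E * (k - B)"
proof (cases "r \<le> 0")
  case True
  have "0 \<le> 2 * B * int d" using assms by simp
  hence "0 < k - B" using assms by linarith
  hence "0 < E * (k - B)" using assms by simp
  moreover have "int g * r \<le> 0" using True by (simp add: mult_nonneg_nonpos)
  ultimately show ?thesis by linarith
next
  case False
  have "int i * (int g * r) \<le> int i * ((int i - 1) * r)"
    using False assms by (intro mult_left_mono mult_right_mono) auto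
  also have "\<dots> = (int i - 1) * (int i * r)" by simp
  also have "\<dots> \<le> (int i - 1) * (E * (k + B))"
    using assms by (intro mult_left_mono) auto
  also have "\<dots> < int i * (E * (k - B))"
  proof -
    have "2 * B * int i \<le> 2 * B * int d" using assms by (intro mult_left_mono) auto
    hence "0 < k + B - 2 * B * int i" using assms by linarith
    hence "0 < E * (k + B - 2 * B * int i)" using assms by simp
    thus ?thesis by (simp add: algebra_simps)
  qed
  finally show ?thesis using assms by (simp add: mult_less_cancel_left)
qed

text \<open>The Newton polygon of \<open>\<Sum>\<^sub>l c\<^sub>l x\<^sup>l\<close> with \<open>c\<^sub>i\<close> of hugely negative valuation \<open>- k\<close> has only the
  vertices \<open>0, i, d\<close>; a slope \<open>r\<close> not matching an edge meets it in a single vertex.\<close>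

lemma newton_unique_min:
  fixes e :: "nat \<Rightarrow> int" and r E B k :: int
  assumes E: "E > 0" and i: "i \<le> d" and B: "B \<ge> 0" "\<And>l. l \<in> S \<Longrightarrow> \<bar>e l\<bar> \<le> B"
    and k: "k > B + 2 * B * int d" and S: "i \<noteq> 0 \<Longrightarrow> 0 \<in> S" "i \<noteq> d \<Longrightarrow> d \<in> S" "S \<subseteq> {..d} - {i}"
    and n0: "i \<noteq> 0 \<Longrightarrow> int i * r \<noteq> E * (e 0 + k)"
    and nd: "i \<noteq> d \<Longrightarrow> int (d - i) * r \<noteq> - (E * (e d + k))"
  defines "T \<equiv> (\<lambda>l. if l = i then int i * r - E * k else E * e l + int l * r)"
  shows "\<exists>l0\<in>insert i S. \<forall>l\<in>S \<union> {i}. l \<noteq> l0 \<longrightarrow> T l > T l0"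
proof -
  have eB: "- (E * B) \<le> E * e l" "E * e l \<le> E * B" if "l \<in> S" for l
  proof -
    have "- B \<le> e l" "e l \<le> B" using B(2)[OF that] by auto
    hence "E * - B \<le> E * e l" "E * e l \<le> E * B" using E by (intro mult_left_mono; simp)+
    thus "- (E * B) \<le> E * e l" "E * e l \<le> E * B" by auto
  qed
  \<comment> \<open>\<open>T l\<close> is the valuation of term \<open>l\<close> at a point of
    valuation \<open>r\<close>. A slope beyond the edge from \<open>i\<close> to 0 puts the minimum
    at 0, one beyond the edge to \<open>d\<close> puts it at \<open>d\<close>, and otherwise it is
    at \<open>i\<close>; \<open>n0\<close> and \<open>nd\<close> exclude ties.\<close>
  consider "i \<noteq> 0" "int i * r > E * (e 0 + k)" | "i \<noteq> d" "int (d - i) * r < - (E * (e d + k))"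
    | "i \<noteq> 0 \<Longrightarrow> int i * r < E * (e 0 + k)" "i \<noteq> d \<Longrightarrow> int (d - i) * r > - (E * (e d + k))"
    using n0 nd by (metis linorder_neqE)
  thus ?thesis
  proof cases
    case 1
    have S0: "0 \<in> S" using S 1 by simp
    have "E * (k - B) < int i * r" using 1 eB(1)[OF S0] by (simp add: algebra_simps)
    hence r: "r > 2 * B * E" using steep_slope[of i d E B k r] 1 i E B k by simp
    have "T l > T 0" if l: "l \<in> S \<union> {i}" "l \<noteq> 0" for l
    proof (cases "l = i")
      case True
      thus ?thesis using 1 by (simp add: T_def algebra_simps)
    next
      case False
      have "0 \<le> 2 * B * E" using B E by simp
      hence "1 * r \<le> int l * r" using l r by (intro mult_right_mono) auto
      moreover have "2 * B * E = E * B + E * B" by simp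
      moreover have "T l = E * e l + int l * r" "T 0 = E * e 0" using False 1 by (simp_all add: T_def)
      moreover have "l \<in> S" using l False by simp
      ultimately show ?thesis using r eB[of l] eB[OF S0] by linarith
    qed
    thus ?thesis using S0 by blast
  next
    case 2
    have Sd: "d \<in> S" using S 2 by simp
    have "E * (k - B) < int (d - i) * (- r)" using 2 eB(1)[OF Sd] by (simp add: algebra_simps)
    hence r: "- r > 2 * B * E" using steep_slope[of "d - i" d E B k "- r"] 2 i E B k by simp
    have "T l > T d" if l: "l \<in> S \<union> {i}" "l \<noteq> d" for l
    proof -
      have ld: "l < d" using l S(3) i by force
      have "int (d - l) = int d - int l" using ld by simp
      show ?thesis
      proof (cases "l = i")
        case True
        have "int (d - i) * r = int d * r - int i * r" using i by (simp add: of_nat_diff algebra_simps)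
        thus ?thesis using 2 True by (simp add: T_def algebra_simps)
      next
        case False
        have "0 \<le> 2 * B * E" using B E by simp
        hence "1 * (- r) \<le> int (d - l) * (- r)" using ld r by (intro mult_right_mono) auto
        hence "int d * r - int l * r \<le> r" unfolding \<open>int (d - l) = _\<close> by (simp add: algebra_simps)
        moreover have "2 * B * E = E * B + E * B" by simp
        moreover have "T l = E * e l + int l * r" "T d = E * e d + int d * r"
          using False 2 by (simp_all add: T_def)
        moreover have "l \<in> S" using l False by simp
        ultimately show ?thesis using r eB[of l] eB[OF Sd] by linarith
      qed
    qed
    thus ?thesis using Sd by blast
  next
    case 3
    have "T l > T i" if l: "l \<in> S \<union> {i}" "l \<noteq> i" for l
    proof -
      have lS: "l \<in> S" using l by simp
      have "E * (e l + k) > (int i - int l) * r"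
      proof (cases "l < i")
        case True
        have S0: "0 \<in> S" using S True by simp
        show ?thesis
        proof (cases "l = 0")
          case False
          have "int i * r < E * (k + B)" using 3(1) True eB(2)[OF S0] by (simp add: algebra_simps)
          hence "int (i - l) * r < E * (k - B)"
            using shallow_slope[of "i - l" i d E B k r] True False i E B k by simp
          thus ?thesis using eB(1)[OF lS] True by (simp add: of_nat_diff algebra_simps)
        qed (use 3 True in simp)
      next
        case False
        hence il: "i < l" using l by simp
        have ld: "l \<le> d" using lS S by auto
        have Sd: "d \<in> S" using S il ld by simp
        show ?thesis
        proof (cases "l = d")
          case True
          thus ?thesis using 3(2) il by (simp add: of_nat_diff algebra_simps)
        next
          case False
          have "int (d - i) * (- r) < E * (k + B)" using 3(2) il ld eB(2)[OF Sd] by (simp add: algebra_simps)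
          hence "int (l - i) * (- r) < E * (k - B)"
            using shallow_slope[of "l - i" "d - i" d E B k "- r"] il ld False i E B k by simp
          thus ?thesis using eB(1)[OF lS] il by (simp add: of_nat_diff algebra_simps)
        qed
      qed
      thus ?thesis using l by (simp add: T_def algebra_simps)
    qed
    thus ?thesis by blast
  qed
qed

lemma exists_coefficient_no_Qab_root:
  fixes c :: "nat \<Rightarrow> rat"
  assumes i: "i \<le> d" and c0: "i \<noteq> 0 \<Longrightarrow> c 0 \<noteq> 0" and cd: "i \<noteq> d \<Longrightarrow> c d \<noteq> 0" and d: "d \<ge> 3" "d \<noteq> 4"
    and mid: "i = 0 \<or> i = d \<or> 3 \<le> i \<and> 3 \<le> d - i \<and> \<not> (i = 4 \<and> d - i = 4)"
  shows "\<exists>a. a \<noteq> 0 \<and> (\<forall>x\<in>Qab. (\<Sum>l\<le>d. of_rat ((c(i := a)) l) * x ^ l) \<noteq> 0)"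
proof -
  \<comment> \<open>If \<open>i\<close> is an end, the only edge has length \<open>d\<close>, and
    both lengths are set to \<open>d\<close> so that \<open>choose_prime\<close> applies;
    \<open>d \<noteq> 4\<close> then excludes the pair 4, 4.\<close>
  define i' where "i' = (if i = 0 then d else i)"
  define j' where "j' = (if i = d then d else d - i)"
  have "i' \<ge> 3" "j' \<ge> 3" "\<not> (i' = 4 \<and> j' = 4)"
    using d mid by (auto simp: i'_def j'_def)
  then obtain p where p: "prime p"
    and choice: "\<And>e f B. \<exists>k\<ge>B. ramification_avoids p i' (e + k) \<and> ramification_avoids p j' (f + k)"
    using choose_prime by blast
  have p0: "p > 0" "p > 1" using p prime_gt_0_nat prime_gt_1_nat by blast+
  define S where "S = {l. l \<le> d \<and> l \<noteq> i \<and> c l \<noteq> 0}"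
  have "\<exists>e. \<forall>l\<in>S. padic_exponent p (c l) (e l)"
    using padic_exponent_exists[OF p] unfolding S_def by (intro bchoice) auto
  then obtain e where e: "\<And>l. l \<in> S \<Longrightarrow> padic_exponent p (c l) (e l)" by blast
  have finS: "finite S" by (simp add: S_def)
  define B where "B = (\<Sum>l\<in>S. \<bar>e l\<bar>)"
  have B: "B \<ge> 0" "\<And>l. l \<in> S \<Longrightarrow> \<bar>e l\<bar> \<le> B"
    using finS unfolding B_def by (auto intro: sum_nonneg member_le_sum)
  obtain k where k: "k \<ge> B + 2 * B * int d + 1" "ramification_avoids p i' (e 0 + k)"
    "ramification_avoids p j' (e d + k)" using choice by blast
  define a :: rat where "a = of_nat p powi (- k)"
  have pa: "padic_exponent p a (- k)"
    unfolding padic_exponent_def a_def by (intro exI[of _ 1]) (use p0 in auto)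
  have "(\<Sum>l\<le>d. of_rat ((c(i := a)) l) * x ^ l) \<noteq> 0" if x: "x \<in> Qab" for x
  proof (cases "x = 0")
    case True
    have "(\<Sum>l\<le>d. of_rat ((c(i := a)) l) * x ^ l) = of_rat ((c(i := a)) 0) * x ^ 0"
      using True by (intro sum.remove[THEN trans]) (auto intro!: sum.neutral)
    also have "\<dots> \<noteq> 0" using c0 p0 by (simp add: a_def)
    finally show ?thesis .
  next
    case False
    obtain K v s where vf: "valued_field K v" and xK: "x \<in> K"
      and vp: "v (of_nat p) = int (p ^ s * (p - 1))" and v0: "\<forall>k. \<not> p dvd k \<longrightarrow> v (of_nat k) = 0"
      using Qab_valuation[OF p x] by blast
    interpret valued_field K v by (rule vf)
    define E where "E = int (p ^ s * (p - 1))"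
    have E0: "E > 0" using p0 by (simp add: E_def)
    define r where "r = v x"
    define f where "f l = of_rat ((c(i := a)) l) * x ^ l" for l
    have vE: "q \<noteq> 0" "v (of_rat q) = E * t" if "padic_exponent p q t" for q t
      using v_padic_exponent[OF p vp _ that] v0 unfolding E_def by blast+
    define T where "T l = (if l = i then int i * r - E * k else E * e l + int l * r)" for l
    have vf: "f l \<noteq> 0 \<and> v (f l) = T l" if "l \<in> S \<union> {i}" for l
    proof -
      define t where "t = (if l = i then - k else e l)"
      have "padic_exponent p ((c(i := a)) l) t" using that e pa by (auto simp: t_def)
      note vE[OF this]
      moreover from this have "v (f l) = v (of_rat ((c(i := a)) l)) + v (x ^ l)"
        unfolding f_def by (intro v_mult) (use False xK in auto)
      moreover have "v (x ^ l) = int l * r" using v_power xK False by (simp add: r_def)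
      ultimately show ?thesis using False by (auto simp: f_def T_def t_def)
    qed
    have avoid: "int i * r \<noteq> E * (e 0 + k)" if "i \<noteq> 0"
      using k(2) that unfolding ramification_avoids_def i'_def E_def by (metis dvd_triv_left)
    have "int (d - i) * r \<noteq> - (E * (e d + k))" if "i \<noteq> d"
      using k(3) that unfolding ramification_avoids_def j'_def E_def
      by (metis dvd_triv_left dvd_minus_iff)
    hence "\<exists>l0\<in>insert i S. \<forall>l\<in>S \<union> {i}. l \<noteq> l0 \<longrightarrow> T l > T l0"
      unfolding T_def using E0 i B k(1) c0 cd avoid
      by (intro newton_unique_min[where B = B and d = d]) (auto simp: S_def)
    then obtain l0 where l0: "l0 \<in> insert i S" "\<And>l. l \<in> S \<union> {i} \<Longrightarrow> l \<noteq> l0 \<Longrightarrow> T l > T l0" by blast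
    have "sum f {..d} \<noteq> 0"
    proof (rule sum_nonzero_if_unique_min[where ?i0.0 = l0])
      show "f l \<in> K" if "l \<in> {..d}" for l unfolding f_def using xK by auto
      show "l0 \<in> {..d}" using l0(1) i by (auto simp: S_def)
      show "f l0 \<noteq> 0" using vf l0(1) by auto
      show "f l = 0 \<or> v (f l) > v (f l0)" if "l \<in> {..d}" "l \<noteq> l0" for l
      proof (cases "l \<in> S \<union> {i}")
        case True
        thus ?thesis using vf[OF True] vf[of l0] l0 that by auto
      next
        case False
        thus ?thesis using that by (auto simp: f_def S_def)
      qed
    qed simp
    thus ?thesis by (simp add: f_def)
  qed
  moreover have "a \<noteq> 0" using p0 by (simp add: a_def)
  ultimately show ?thesis by blast
qed

section \<open>Cubics\<close>

text \<open>Divide the difference of the equations by \<open>x - y\<close>; times \<open>2 a\<close>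
  it is a sum of three squares plus \<open>2 c a - b^2\<close>. The condition is stronger than
  \<open>b^2 < 3 a c\<close>, which excludes critical points, but shows the squares
  directly.\<close>

lemma cubic_two_real_roots:
  fixes a b c e x y :: real
  assumes "b ^ 2 < 2 * c * a" "x \<noteq> y"
    and "a * x ^ 3 + b * x ^ 2 + c * x + e = 0" "a * y ^ 3 + b * y ^ 2 + c * y + e = 0"
  shows False
proof -
  have "(x - y) * (a * (x ^ 2 + x * y + y ^ 2) + b * (x + y) + c) = 0"
    using assms(3,4) by (simp add: algebra_simps power2_eq_square power3_eq_cube)
  hence "a * (x ^ 2 + x * y + y ^ 2) + b * (x + y) + c = 0" using assms(2) by simp
  hence "2 * a * (a * (x ^ 2 + x * y + y ^ 2) + b * (x + y) + c) = 0" by simp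
  moreover have "2 * a * (a * (x ^ 2 + x * y + y ^ 2) + b * (x + y) + c) =
    (a * x + a * y + b) ^ 2 + (a * x) ^ 2 + (a * y) ^ 2 + (2 * c * a - b ^ 2)"
    by (simp add: algebra_simps power2_eq_square)
  moreover have "0 \<le> (a * x + a * y + b) ^ 2" "0 \<le> (a * x) ^ 2" "0 \<le> (a * y) ^ 2" by simp_all
  ultimately show False using assms(1) by linarith
qed

text \<open>Vieta: the difference quotient yields \<open>c\<close>, and then the first equation
  yields \<open>e\<close>, as symmetric functions of \<open>x\<close>, \<open>y\<close>,
  \<open>t\<close> scaled by \<open>a\<close>.\<close>

lemma cubic_third_root:
  fixes a b c e x y t :: complex
  assumes "a * x ^ 3 + b * x ^ 2 + c * x + e = 0" "a * y ^ 3 + b * y ^ 2 + c * y + e = 0" "x \<noteq> y"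
    and t: "b = - a * (x + y + t)"
  shows "a * t ^ 3 + b * t ^ 2 + c * t + e = 0"
proof -
  have "(x - y) * (a * (x ^ 2 + x * y + y ^ 2) + b * (x + y) + c) =
    (a * x ^ 3 + b * x ^ 2 + c * x + e) - (a * y ^ 3 + b * y ^ 2 + c * y + e)"
    by (simp add: algebra_simps power2_eq_square power3_eq_cube)
  hence "(x - y) * (a * (x ^ 2 + x * y + y ^ 2) + b * (x + y) + c) = 0"
    unfolding assms(1,2) by simp
  hence 0: "a * (x ^ 2 + x * y + y ^ 2) + b * (x + y) + c = 0"
    unfolding mult_eq_0_iff using assms(3) by simp
  have "c - a * (x * y + x * t + y * t) = a * (x ^ 2 + x * y + y ^ 2) + b * (x + y) + c"
    unfolding t by (simp add: algebra_simps power2_eq_square)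
  hence c: "c = a * (x * y + x * t + y * t)" using 0 by simp
  have "e - - a * x * y * t = a * x ^ 3 + b * x ^ 2 + c * x + e"
    unfolding t c by (simp add: algebra_simps power2_eq_square power3_eq_cube)
  hence e: "e = - a * x * y * t" unfolding assms(1) right_minus_eq .
  show ?thesis unfolding t c e by (simp add: algebra_simps power2_eq_square power3_eq_cube)
qed

lemma of_rat_complex_of_real: "(of_rat q :: complex) = of_real (of_rat q)"
  by (cases q) (simp add: of_rat_rat)

text \<open>By \<open>disc\<close> there is at most one real root, so a real root in a cyclotomic
  field would be rational. A nonreal root \<open>x\<close> brings \<open>cnj x\<close> along, and
  Vieta puts the third root, which is real, into the same field.\<close>

lemma cubic_no_Qab_root:
  fixes c3 c2 c1 c0 :: rat
  assumes "c3 \<noteq> 0" and disc: "c2 ^ 2 < 2 * c1 * c3"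
    and norat: "\<And>q. c3 * q ^ 3 + c2 * q ^ 2 + c1 * q + c0 \<noteq> 0" and x: "x \<in> Qab"
  shows "of_rat c3 * x ^ 3 + of_rat c2 * x ^ 2 + of_rat c1 * x + of_rat c0 \<noteq> 0"
proof
  assume root: "of_rat c3 * x ^ 3 + of_rat c2 * x ^ 2 + of_rat c1 * x + of_rat c0 = 0"
  define F where "F = [:c0, c1, c2, c3:]"
  have F: "rpoly F y = of_rat c3 * y ^ 3 + of_rat c2 * y ^ 2 + of_rat c1 * y + of_rat c0" for y
    by (simp add: F_def algebra_simps power2_eq_square power3_eq_cube)
  obtain n where n: "n > 0" "x \<in> cyclotomic_field n"
    using x unfolding Qab_def by (auto simp: Suc_le_eq)
  define K where "K = Qadj (zeta n)"
  obtain M where "is_minpoly (zeta n) M" using zeta_minpoly n by blast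
  hence sf: "is_subfield K" unfolding K_def by (rule Qadj_subfield)
  have xK: "x \<in> K" using cyclotomic_field_subset_Qadj n by (auto simp: K_def)
  have no_real: False if y: "y \<in> K" "cnj y = y" "rpoly F y = 0" for y
  proof -
    have uniq: "y' = y" if "cnj y' = y'" "rpoly F y' = 0" for y'
    proof (rule ccontr)
      assume "y' \<noteq> y"
      define r r' where "r = Re y" and "r' = Re y'"
      have r: "y = of_real r" "y' = of_real r'"
        using y(2) that(1) by (simp_all add: complex_eq_iff r_def r'_def)
      have disc': "(of_rat c2 :: real) ^ 2 < 2 * of_rat c1 * of_rat c3"
      proof -
        have "(of_rat (c2 ^ 2) :: real) < of_rat (2 * c1 * c3)" using disc by (simp only: of_rat_less)
        thus ?thesis by (simp add: of_rat_power of_rat_mult)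
      qed
      have neq: "r' \<noteq> r" using \<open>y' \<noteq> y\<close> r by auto
      have real_root: "of_rat c3 * s ^ 3 + of_rat c2 * s ^ 2 + of_rat c1 * s + of_rat c0 = 0"
        if "rpoly F (of_real s) = 0" for s :: real
        using that unfolding F of_rat_complex_of_real
        by (simp only: of_real_eq_0_iff flip: of_real_power of_real_mult of_real_add)
      show False
        by (rule cubic_two_real_roots[OF disc' neq real_root real_root])
          (use y(3) that(2) r in auto)
    qed
    have "y \<in> \<rat>"
      by (rule real_cyclotomic_unique_root_rational[OF n(1) _ y(2,3)]) (use y(1) uniq in \<open>auto simp: K_def\<close>)
    then obtain q where q: "y = of_rat q" by (auto elim: Rats_cases)
    have "rpoly F y = of_rat (c3 * q ^ 3 + c2 * q ^ 2 + c1 * q + c0)"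
      unfolding F q by (simp add: of_rat_add of_rat_mult of_rat_power)
    thus False using y(3) norat[of q] by simp
  qed
  show False
  proof (cases "cnj x = x")
    case True
    thus False using no_real[OF xK True] root by (simp add: F)
  next
    case False
    define t where "t = of_rat (- c2 / c3) - x - cnj x"
    have cK: "cnj x \<in> K" using Qadj_zeta_cnj n xK by (simp add: K_def)
    have rK: "of_rat q \<in> K" for q
    proof -
      have "rpoly [:q:] (zeta n) = of_rat q" by simp
      thus ?thesis unfolding K_def Qadj_def by (metis rangeI)
    qed
    have diff: "u - w \<in> K" if "u \<in> K" "w \<in> K" for u w
    proof -
      have "u + - w \<in> K" using sf that unfolding is_subfield_def is_subring_def by blast
      thus ?thesis by simp
    qed
    have "t \<in> K" unfolding t_def by (intro diff rK xK cK)
    moreover have "cnj t = t" by (simp add: t_def)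
    moreover have "rpoly F t = 0"
    proof -
      have "rpoly F (cnj x) = cnj (rpoly F x)" by (simp add: cnj_rpoly)
      hence "rpoly F (cnj x) = 0" using root by (simp add: F)
      moreover have "of_rat c2 = - of_rat c3 * (x + cnj x + t)"
        using assms(1) by (simp add: t_def of_rat_divide of_rat_minus)
      ultimately show ?thesis using cubic_third_root[of "of_rat c3" x "of_rat c2" "of_rat c1" "of_rat c0" "cnj x" t]
          root False unfolding F by metis
    qed
    ultimately show False using no_real by blast
  qed
qed

text \<open>By the rational root theorem a root is \<open>u / w\<close> with \<open>u\<close>
  dividing \<open>C0\<close> and \<open>w\<close> dividing \<open>C3\<close>, independently of
  \<open>A\<close>; each of these finitely many roots determines \<open>A\<close>.\<close>

lemma cubic_int_rational_roots_finite:
  fixes C3 C2 C0 :: int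
  assumes "C3 \<noteq> 0" "C0 \<noteq> 0"
  shows "finite {A::int. \<exists>q::rat. of_int C3 * q ^ 3 + of_int C2 * q ^ 2 + of_int A * q + of_int C0 = 0}"
    (is "finite ?S")
proof -
  define h :: "int \<times> int \<Rightarrow> rat" where
    "h = (\<lambda>(u, w). - (of_int C3 * (of_int u / of_int w) ^ 3 + of_int C2 * (of_int u / of_int w) ^ 2 + of_int C0) /
       (of_int u / of_int w))"
  have "of_int ` ?S \<subseteq> h ` ({- \<bar>C0\<bar>..\<bar>C0\<bar>} \<times> {- \<bar>C3\<bar>..\<bar>C3\<bar>})"
  proof (rule image_subsetI)
    fix A assume "A \<in> ?S"
    then obtain q :: rat where q: "of_int C3 * q ^ 3 + of_int C2 * q ^ 2 + of_int A * q + of_int C0 = 0" by blast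
    have q0: "q \<noteq> 0" using q assms by auto
    obtain u w where uw: "q = Rat.Fract u w" "w > 0" "coprime u w" by (cases q)
    have quw: "q = of_int u / of_int w" using uw by (simp add: Fract_of_int_quotient)
    have "of_int (C3 * u ^ 3 + C2 * u ^ 2 * w + A * u * w ^ 2 + C0 * w ^ 3) =
      (of_int w ^ 3 * (of_int C3 * q ^ 3 + of_int C2 * q ^ 2 + of_int A * q + of_int C0) :: rat)"
      using uw(2) unfolding quw by (simp add: field_simps power2_eq_square power3_eq_cube)
    hence eq: "C3 * u ^ 3 + C2 * u ^ 2 * w + A * u * w ^ 2 + C0 * w ^ 3 = 0"
      unfolding q mult_zero_right by (simp only: of_int_eq_0_iff)
    have "C0 * w ^ 3 = u * - (C3 * u ^ 2 + C2 * u * w + A * w ^ 2)"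
      using eq by (simp add: algebra_simps power2_eq_square power3_eq_cube)
    hence "u dvd C0 * w ^ 3" by (metis dvd_triv_left)
    moreover have "coprime u (w ^ 3)" using uw(3) by simp
    ultimately have "u dvd C0" by (simp add: coprime_dvd_mult_left_iff)
    hence u: "\<bar>u\<bar> \<le> \<bar>C0\<bar>" using assms by (simp add: dvd_imp_le_int)
    have "C3 * u ^ 3 = w * - (C2 * u ^ 2 + A * u * w + C0 * w ^ 2)"
      using eq by (simp add: algebra_simps power2_eq_square power3_eq_cube)
    hence "w dvd C3 * u ^ 3" by (metis dvd_triv_left)
    moreover have "coprime w (u ^ 3)" using uw(3) by (simp add: coprime_commute)
    ultimately have "w dvd C3" by (simp add: coprime_dvd_mult_left_iff)
    hence w: "\<bar>w\<bar> \<le> \<bar>C3\<bar>" using assms by (simp add: dvd_imp_le_int)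
    have "of_int A * q = - (of_int C3 * q ^ 3 + of_int C2 * q ^ 2 + of_int C0)"
      using q by (simp add: eq_neg_iff_add_eq_0 algebra_simps)
    hence "of_int A = - (of_int C3 * q ^ 3 + of_int C2 * q ^ 2 + of_int C0) / q"
      unfolding nonzero_eq_divide_eq[OF q0] .
    hence "of_int A = h (u, w)" unfolding h_def case_prod_conv quw .
    thus "of_int A \<in> h ` ({- \<bar>C0\<bar>..\<bar>C0\<bar>} \<times> {- \<bar>C3\<bar>..\<bar>C3\<bar>})"
      using u w by (intro image_eqI[of _ _ "(u, w)"]) auto
  qed
  hence "finite ((of_int :: int \<Rightarrow> rat) ` ?S)" by (rule finite_subset) simp
  thus ?thesis by (rule finite_imageD) (simp add: inj_on_def)
qed

lemma exists_cubic_linear_coefficient: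
  fixes c3 c2 c0 :: rat
  assumes "c3 \<noteq> 0" "c0 \<noteq> 0"
  shows "\<exists>a. c2 ^ 2 < 2 * a * c3 \<and> (\<forall>q. c3 * q ^ 3 + c2 * q ^ 2 + a * q + c0 \<noteq> 0)"
proof -
  obtain m where m: "m > 0" "\<And>i. of_nat m * coeff [:c0, c2, c3:] i \<in> \<int>"
    using poly_common_denominator by blast
  obtain C0 C2 C3 where C: "of_nat m * c0 = of_int C0" "of_nat m * c2 = of_int C2" "of_nat m * c3 = of_int C3"
    using m(2)[of 0] m(2)[of 1] m(2)[of 2] by (auto simp: numeral_2_eq_2 elim!: Ints_cases)
  have nz: "C0 \<noteq> 0" "C3 \<noteq> 0" using C assms m(1) by auto
  \<comment> \<open>The factor \<open>C3\<close> makes \<open>g t * C3\<close> at least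
    \<open>C2 ^ 2 + 1\<close>, whatever its sign; \<open>t\<close> supplies infinitely many
    candidates against finitely many with a rational root.\<close>
  define g where "g t = C3 * (C2 ^ 2 + 1 + int t)" for t
  have "inj g" using nz by (auto simp: g_def inj_on_def)
  hence "infinite (range g)" by (rule range_inj_infinite)
  then obtain t where t: "g t \<notin> {A::int. \<exists>q::rat. of_int C3 * q ^ 3 + of_int C2 * q ^ 2 + of_int A * q + of_int C0 = 0}"
    using cubic_int_rational_roots_finite[OF nz(2,1), of C2] by (meson finite_subset image_subset_iff rangeI UNIV_I)
  define a :: rat where "a = of_int (g t) / of_nat m"
  have am: "of_nat m * a = of_int (g t)" using m(1) by (simp add: a_def)
  have "C2 ^ 2 < 2 * g t * C3"
  proof -
    define y where "y = C2 ^ 2 + 1 + int t"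
    have "1 * y \<le> C3 ^ 2 * y"
      using nz by (intro mult_right_mono) (auto simp: int_one_le_iff_zero_less y_def)
    moreover have "2 * g t * C3 = C3 ^ 2 * y + C3 ^ 2 * y"
      by (simp add: g_def y_def power2_eq_square algebra_simps)
    moreover have "0 \<le> C2 ^ 2" by simp
    hence "C2 ^ 2 < y" "0 < y" unfolding y_def by linarith+
    ultimately show ?thesis by linarith
  qed
  hence "(of_int (C2 ^ 2) :: rat) < of_int (2 * g t * C3)" by (simp only: of_int_less_iff)
  hence "(of_nat m * c2) ^ 2 < 2 * (of_nat m * a) * (of_nat m * c3)" by (simp add: C am)
  hence "of_nat m ^ 2 * c2 ^ 2 < of_nat m ^ 2 * (2 * a * c3)" by (simp add: algebra_simps power2_eq_square)
  hence "c2 ^ 2 < 2 * a * c3" using m(1) by (simp add: mult_less_cancel_left)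
  moreover have "c3 * q ^ 3 + c2 * q ^ 2 + a * q + c0 \<noteq> 0" for q
  proof
    assume "c3 * q ^ 3 + c2 * q ^ 2 + a * q + c0 = 0"
    hence "of_nat m * (c3 * q ^ 3 + c2 * q ^ 2 + a * q + c0) = 0" by simp
    hence "of_int C3 * q ^ 3 + of_int C2 * q ^ 2 + of_int (g t) * q + of_int C0 = 0"
      unfolding C[symmetric] am[symmetric] by (simp add: algebra_simps)
    thus False using t by blast
  qed
  ultimately show ?thesis by blast
qed

lemma exists_cubic_coefficient_no_Qab_root:
  fixes c :: "nat \<Rightarrow> rat"
  assumes i: "i = 1 \<or> i = 2" and c: "c 0 \<noteq> 0" "c 3 \<noteq> 0"
  shows "\<exists>a. \<forall>x\<in>Qab. (\<Sum>l\<le>3. of_rat ((c(i := a)) l) * x ^ l) \<noteq> 0"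
proof -
  have sum3: "(\<Sum>l\<le>3. f l) = f 3 + f 2 + f 1 + f 0" for f :: "nat \<Rightarrow> complex"
    by (simp add: numeral_3_eq_3 numeral_2_eq_2)
  from i show ?thesis
  proof
    assume "i = 1"
    obtain a where "c 2 ^ 2 < 2 * a * c 3" "\<And>q. c 3 * q ^ 3 + c 2 * q ^ 2 + a * q + c 0 \<noteq> 0"
      using exists_cubic_linear_coefficient[OF c(2,1)] by blast
    from cubic_no_Qab_root[OF c(2) this] show ?thesis
      unfolding sum3 \<open>i = 1\<close> by (intro exI[of _ a]) simp
  next
    assume "i = 2"
    \<comment> \<open>The reversed cubic has the free coefficient in the linear place, and its roots
      are the inverses.\<close>
    obtain a where a: "c 1 ^ 2 < 2 * a * c 0" "\<And>q. c 0 * q ^ 3 + c 1 * q ^ 2 + a * q + c 3 \<noteq> 0"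
      using exists_cubic_linear_coefficient[OF c] by blast
    have "of_rat (c 3) * x ^ 3 + of_rat a * x ^ 2 + of_rat (c 1) * x + of_rat (c 0) \<noteq> 0" if x: "x \<in> Qab" for x
    proof
      assume root: "of_rat (c 3) * x ^ 3 + of_rat a * x ^ 2 + of_rat (c 1) * x + of_rat (c 0) = 0"
      hence x0: "x \<noteq> 0" using c by auto
      define y where "y = inverse x"
      have "of_rat (c 0) * y ^ 3 + of_rat (c 1) * y ^ 2 + of_rat a * y + of_rat (c 3) =
        y ^ 3 * (of_rat (c 3) * x ^ 3 + of_rat a * x ^ 2 + of_rat (c 1) * x + of_rat (c 0))"
        using x0 by (simp add: y_def field_simps power2_eq_square power3_eq_cube)
      thus False using cubic_no_Qab_root[OF c(1) a Qab_inverse[OF x]] root by (simp add: y_def)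
    qed
    thus ?thesis unfolding sum3 \<open>i = 2\<close> by (intro exI[of _ a]) simp
  qed
qed

section \<open>The game\<close>

definition undecided :: "nat \<Rightarrow> (nat \<Rightarrow> rat option) \<Rightarrow> nat set" where
  "undecided d s = {i. i \<le> d \<and> s i = None}"

lemma finite_undecided [simp]: "finite (undecided d s)"
  by (simp add: undecided_def)

lemma undecided_update: "undecided d (s(i \<mapsto> v)) = undecided d s - {i}"
  by (auto simp: undecided_def)

lemma undecided_card_1:
  assumes "card (undecided d s) = 1"
  shows "\<exists>i\<le>d. s i = None \<and> (\<forall>j\<le>d. j \<noteq> i \<longrightarrow> s j \<noteq> None)"
proof -
  obtain i where i: "undecided d s = {i}" using assms card_1_singletonE by blast
  have "j \<le> d \<and> s j = None \<longleftrightarrow> j = i" for j using i by (auto simp: undecided_def)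
  thus ?thesis by metis
qed

lemma the_update_conv: "the ((s(i \<mapsto> v)) l) = ((\<lambda>l. the (s l))(i := v)) l"
  by simp

text \<open>\<open>B\<close> holds the indices that must not be left for last. With \<open>n\<close>
  odd moves remaining it is Nora's turn, and she has \<open>(n - 1) / 2\<close> moves before her
  last; the invariant says that these suffice to fill what is left of \<open>B\<close>, with the
  value 1.\<close>

lemma nora_wins:
  fixes B :: "nat set"
  assumes D: "D \<subseteq> Qab"
    and final: "\<And>c i. i \<le> d \<Longrightarrow> i \<notin> B \<Longrightarrow> (i \<noteq> 0 \<Longrightarrow> c 0 \<noteq> 0) \<Longrightarrow> (i \<noteq> d \<Longrightarrow> c d \<noteq> 0) \<Longrightarrow>
      \<exists>a. (i = 0 \<or> i = d \<longrightarrow> a \<noteq> 0) \<and> (\<forall>x\<in>Qab. (\<Sum>l\<le>d. of_rat ((c(i := a)) l) * x ^ l) \<noteq> 0)"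
  shows "card (undecided d s) = n \<Longrightarrow> s 0 \<noteq> Some 0 \<Longrightarrow> s d \<noteq> Some 0 \<Longrightarrow>
    2 * card (undecided d s \<inter> B) + 1 \<le> n \<Longrightarrow> t = even n \<Longrightarrow> N d D t n s"
proof (induction n arbitrary: s t)
  case (Suc n)
  have move: "N d D (\<not> t) n (s(i \<mapsto> v))"
    if i: "legal_move d s i v" and b: "2 * card (undecided d s \<inter> B - {i}) + 1 \<le> n" for i v
  proof (rule Suc.IH)
    have "i \<in> undecided d s" using i by (auto simp: legal_move_def undecided_def)
    thus "card (undecided d (s(i \<mapsto> v))) = n"
      using Suc.prems(1) by (simp add: undecided_update)
    show "(s(i \<mapsto> v)) 0 \<noteq> Some 0" "(s(i \<mapsto> v)) d \<noteq> Some 0"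
      using i Suc.prems by (auto simp: legal_move_def)
    have "(undecided d s - {i}) \<inter> B = undecided d s \<inter> B - {i}" by blast
    thus "2 * card (undecided d (s(i \<mapsto> v)) \<inter> B) + 1 \<le> n" using b by (simp add: undecided_update)
    show "(\<not> t) = even n" using Suc.prems by simp
  qed
  show ?case
  proof (cases t)
    case True
    \<comment> \<open>On Wanda's turn the number of remaining moves is even, so the bound has one to
      spare.\<close>
    have "2 * card (undecided d s \<inter> B - {i}) + 1 \<le> n" for i
    proof -
      have "card (undecided d s \<inter> B - {i}) \<le> card (undecided d s \<inter> B)"
        by (intro card_mono) auto
      moreover have "odd n" using Suc.prems True by simp
      ultimately show ?thesis using Suc.prems(4) by presburger
    qed
    thus ?thesis using True move by auto
  next
    case False
    hence even: "even n" using Suc.prems by simp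
    show ?thesis
    proof (cases "n = 0")
      case True
      have empty: "undecided d s \<inter> B = {}" using Suc.prems(4) True by simp
      obtain i where i: "i \<le> d" "s i = None" "\<And>j. j \<le> d \<Longrightarrow> j \<noteq> i \<Longrightarrow> s j \<noteq> None"
        using undecided_card_1[of d s] Suc.prems(1) True by (auto simp del: not_None_eq)
      define c where "c l = the (s l)" for l
      have "i \<notin> B" using i empty by (auto simp: undecided_def)
      moreover have "c 0 \<noteq> 0" if "i \<noteq> 0" using i(3)[of 0] that Suc.prems(2) by (auto simp: c_def)
      moreover have "c d \<noteq> 0" if "i \<noteq> d" using i(3)[of d] that Suc.prems(3) by (auto simp: c_def)
      ultimately obtain a where a: "i = 0 \<or> i = d \<longrightarrow> a \<noteq> 0"
        "\<forall>x\<in>Qab. (\<Sum>l\<le>d. of_rat ((c(i := a)) l) * x ^ l) \<noteq> 0"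
        using final[OF i(1), of c] by blast
      have "legal_move d s i a" using i a by (simp add: legal_move_def)
      moreover have "\<not> has_root_in d D (s(i \<mapsto> a))"
        unfolding has_root_in_def the_update_conv using a(2) D by (auto simp: c_def[abs_def])
      ultimately show ?thesis using False True by auto
    next
      case n0: False
      obtain i where i: "i \<in> undecided d s" "2 * card (undecided d s \<inter> B - {i}) + 1 \<le> n"
      proof (cases "undecided d s \<inter> B = {}")
        case True
        have "undecided d s \<noteq> {}" using Suc.prems(1) by auto
        then obtain i where "i \<in> undecided d s" by blast
        thus ?thesis using that[of i] True n0 by simp
      next
        case False
        then obtain i where i: "i \<in> undecided d s \<inter> B" by blast
        have "card (undecided d s \<inter> B - {i}) = card (undecided d s \<inter> B) - 1"
          using i by (simp add: card_Diff_singleton)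
        moreover have "card (undecided d s \<inter> B) > 0" using i by (auto simp: card_gt_0_iff)
        ultimately show ?thesis using that[of i] i Suc.prems(4) by simp
      qed
      have "legal_move d s i 1" using i by (simp add: legal_move_def undecided_def)
      thus ?thesis using move[OF _ i(2)] False by auto
    qed
  qed
qed simp

text \<open>The integer must not be a zero of the polynomial of the decided coefficients: then
  \<open>v\<close> is nonzero, hence legal at the ends too. That polynomial is nonzero because
  \<open>d > 0\<close> gives an end other than \<open>i\<close>, already decided.\<close>

lemma wanda_last_move:
  assumes d: "d > 0" and D: "is_subring D" and i: "i \<le> d" "s i = None"
    and dec: "\<And>j. j \<le> d \<Longrightarrow> j \<noteq> i \<Longrightarrow> s j \<noteq> None" and nz: "s 0 \<noteq> Some 0" "s d \<noteq> Some 0"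
  shows "\<exists>v. legal_move d s i v \<and> has_root_in d D (s(i \<mapsto> v))"
proof -
  define c where "c l = the (s l)" for l
  define P where "P = (\<Sum>l\<in>{..d} - {i}. monom (c l) l)"
  have coeff: "coeff P l = c l" if "l \<le> d" "l \<noteq> i" for l
    using that by (simp add: P_def coeff_sum)
  have "P \<noteq> 0"
  proof -
    obtain l where "l = 0 \<or> l = d" "l \<noteq> i" using d by (cases "i = 0") auto
    hence "l \<le> d" "c l \<noteq> 0" using dec[of l] nz by (auto simp: c_def)
    thus ?thesis using coeff[of l] \<open>l \<noteq> i\<close> by auto
  qed
  hence "finite {x. poly P x = 0}" by (rule poly_roots_finite)
  moreover have "infinite (range (\<lambda>k. of_nat (Suc k) :: rat))"
    by (rule range_inj_infinite) (simp add: inj_on_def)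
  ultimately obtain k where k: "poly P (of_nat (Suc k)) \<noteq> 0"
    by (metis (mono_tags, lifting) finite_subset image_subsetI mem_Collect_eq)
  define x :: rat where "x = of_nat (Suc k)"
  have x0: "x \<noteq> 0" unfolding x_def using of_nat_neq_0 .
  define v where "v = - poly P x / x ^ i"
  have v0: "v \<noteq> 0" using k x0 by (simp add: v_def x_def)
  have "(\<Sum>l\<le>d. (c(i := v)) l * x ^ l) = v * x ^ i + (\<Sum>l\<in>{..d} - {i}. (c(i := v)) l * x ^ l)"
    using i by (subst sum.remove[of _ i]) auto
  also have "(\<Sum>l\<in>{..d} - {i}. (c(i := v)) l * x ^ l) = poly P x"
    unfolding P_def poly_sum by (rule sum.cong) (auto simp: poly_monom)
  also have "v * x ^ i + poly P x = 0" using x0 by (simp add: v_def)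
  finally have "of_rat (\<Sum>l\<le>d. (c(i := v)) l * x ^ l) = (0 :: complex)" by simp
  hence "(\<Sum>l\<le>d. of_rat ((c(i := v)) l) * of_rat x ^ l) = (0 :: complex)"
    by (simp only: of_rat_sum of_rat_mult of_rat_power)
  moreover have "of_rat x \<in> D"
  proof -
    have "of_nat j \<in> D" for j
      using D by (induction j) (auto simp: is_subring_def)
    thus ?thesis unfolding x_def of_rat_of_nat_eq .
  qed
  ultimately have "has_root_in d D (s(i \<mapsto> v))"
    unfolding has_root_in_def the_update_conv c_def[abs_def] by blast
  moreover have "legal_move d s i v" using i v0 by (simp add: legal_move_def)
  ultimately show ?thesis by blast
qed

lemma wanda_wins:
  assumes d: "d > 0" and D: "is_subring D"
  shows "card (undecided d s) = n \<Longrightarrow> n > 0 \<Longrightarrow> s 0 \<noteq> Some 0 \<Longrightarrow> s d \<noteq> Some 0 \<Longrightarrow> t = odd n \<Longrightarrow> W d D t n s"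
proof (induction n arbitrary: s t)
  case (Suc n)
  have move: "W d D (\<not> t) n (s(i \<mapsto> v))" if i: "legal_move d s i v" and n: "n > 0" for i v
  proof (rule Suc.IH)
    have "i \<in> undecided d s" using i by (auto simp: legal_move_def undecided_def)
    thus "card (undecided d (s(i \<mapsto> v))) = n"
      using Suc.prems(1) by (simp add: undecided_update)
    show "(s(i \<mapsto> v)) 0 \<noteq> Some 0" "(s(i \<mapsto> v)) d \<noteq> Some 0"
      using i Suc.prems by (auto simp: legal_move_def)
    show "(\<not> t) = odd n" using Suc.prems by simp
  qed (rule n)
  show ?case
  proof (cases t)
    case False
    hence "n > 0" using Suc.prems by (auto intro: gr0I)
    thus ?thesis using False move by auto
  next
    case True
    show ?thesis
    proof (cases "n = 0")
      case n0: True
      obtain i where i: "i \<le> d" "s i = None" "\<And>j. j \<le> d \<Longrightarrow> j \<noteq> i \<Longrightarrow> s j \<noteq> None"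
        using undecided_card_1[of d s] Suc.prems(1) n0 by (auto simp del: not_None_eq)
      show ?thesis using wanda_last_move[OF d D i Suc.prems(3,4)] True n0 by auto
    next
      case False
      have "undecided d s \<noteq> {}" using Suc.prems(1) by auto
      then obtain i where "i \<in> undecided d s" by blast
      hence "legal_move d s i 1" by (simp add: legal_move_def undecided_def)
      thus ?thesis using move False True by auto
    qed
  qed
qed simp

theorem theorem4:
  fixes d :: nat and D2 :: "complex set" and wanda_first :: bool
  assumes "d = 3 \<or> d > 8"
    and "is_subring D2" and "D2 \<subseteq> Qab"
  shows "(wanda_makes_move wanda_first (d + 1) \<longrightarrow> wanda_has_winning_strategy d D2 wanda_first)
       \<and> (\<not> wanda_makes_move wanda_first (d + 1) \<longrightarrow> nora_has_winning_strategy d D2 wanda_first)"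
proof (intro conjI impI)
  have all: "undecided d Map.empty = {..d}" by (auto simp: undecided_def)
  {
    assume "wanda_makes_move wanda_first (d + 1)"
    hence "wanda_first = odd (d + 1)" by (auto simp: wanda_makes_move_def split: if_splits)
    moreover have "d > 0" using assms(1) by auto
    ultimately show "wanda_has_winning_strategy d D2 wanda_first"
      unfolding wanda_has_winning_strategy_def
      by (intro wanda_wins assms(2)) (simp_all add: all)
  next
    assume "\<not> wanda_makes_move wanda_first (d + 1)"
    hence first: "wanda_first = even (d + 1)"
      by (auto simp: wanda_makes_move_def split: if_splits)
    \<comment> \<open>For \<open>d > 8\<close> this leaves the ends and edges of length at least 3;
      lengths 4 and 4 would mean \<open>d = 8\<close>. Filling four indices needs
      \<open>2 * 4 + 1 \<le> d + 1\<close>. For \<open>d = 3\<close> the inner indices are covered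
      by the cubic argument.\<close>
    define B where "B = (if d = 3 then {} else {1, 2, d - 1, d - 2})"
    show "nora_has_winning_strategy d D2 wanda_first"
      unfolding nora_has_winning_strategy_def
    proof (rule nora_wins[OF assms(3), where B = B])
      fix c :: "nat \<Rightarrow> rat" and i
      assume i: "i \<le> d" "i \<notin> B" and c: "i \<noteq> 0 \<Longrightarrow> c 0 \<noteq> 0" "i \<noteq> d \<Longrightarrow> c d \<noteq> 0"
      show "\<exists>a. (i = 0 \<or> i = d \<longrightarrow> a \<noteq> 0) \<and>
        (\<forall>x\<in>Qab. (\<Sum>l\<le>d. of_rat ((c(i := a)) l) * x ^ l) \<noteq> 0)"
      proof (cases "d = 3 \<and> (i = 1 \<or> i = 2)")
        case True
        thus ?thesis using exists_cubic_coefficient_no_Qab_root[of i c] c by auto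
      next
        case False
        have "i = 0 \<or> i = d \<or> 3 \<le> i \<and> 3 \<le> d - i \<and> \<not> (i = 4 \<and> d - i = 4)"
          using False i assms(1) by (auto simp: B_def split: if_splits)
        thus ?thesis
          using exists_coefficient_no_Qab_root[OF i(1) c] assms(1) by fastforce
      qed
    next
      have "card ({..d} \<inter> B) \<le> card B" by (intro card_mono) (auto simp: B_def)
      moreover have "card B \<le> (if d = 3 then 0 else 4)"
        by (auto simp: B_def card_insert_if)
      ultimately show "2 * card (undecided d Map.empty \<inter> B) + 1 \<le> d + 1"
        unfolding all using assms(1) by (auto split: if_splits)
    qed (use first in \<open>simp_all add: all\<close>)
  }
qed

end
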